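(* For any fixed $\varepsilon>0$, there is a deterministic one-pass semi-streaming $(4.9108+\varepsilon)$-approximation algorithm for the weighted matching problem. This algorithm processes each input edge in constant time and requires $O(n)$ time at the end of the input to compute the final output, where $n$ is the number of vertices of the input graph.
   Context: Weighted matching problem: given an undirected graph $G=(V,E)$ with non-negative weights $w:E\to\mathbb{R}_+$, compute a matching $M\subseteq E$ (a set of edges no two of which share a vertex) maximizing $w(M)=\sum_{e\in M}w(e)$. An algorithm is a $\rho$-approximation if on every input it outputs a matching $M$ such that the maximum weight of a matching is at most $\rho\cdot w(M)$. Semi-streaming model: the distinct edges of $G$ (with their weights) are revealed sequentially, one at a time, in an arbitrary order. A one-pass algorithm makes a single pass over this stream. With $n=|V|$, the space used by the algorithm is limited to $O(n\cdot\mathrm{polylog}(n))$ bits of memory. Here $\varepsilon$ is a fixed constant. *)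

theory Defs
  imports Complex_Main "HOL-Library.Landau_Symbols"
begin

section \<open>Weighted matching\<close>

definition simple_graph :: "nat \<Rightarrow> nat set set \<Rightarrow> bool" where
  "simple_graph n E \<longleftrightarrow> E \<subseteq> {{u, v} | u v. u < n \<and> v < n \<and> u \<noteq> v}"

definition matching :: "'a set set \<Rightarrow> 'a set set \<Rightarrow> bool" where
  "matching E M \<longleftrightarrow> M \<subseteq> E \<and> (\<forall>e\<in>M. \<forall>f\<in>M. e \<noteq> f \<longrightarrow> e \<inter> f = {})"

definition weight :: "('a set \<Rightarrow> real) \<Rightarrow> 'a set set \<Rightarrow> real" where
  "weight w M = (\<Sum>e\<in>M. w e)"

definition max_matching_weight :: "'a set set \<Rightarrow> ('a set \<Rightarrow> real) \<Rightarrow> real" where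
  "max_matching_weight E w = Max (weight w ` {M. matching E M})"

section \<open>The machine\<close>

text \<open>
  Algorithms are programs of a random access machine with two memories, both initially zero:
  a word memory, whose cells hold natural numbers of a bounded number of bits, and a weight
  memory, whose cells hold edge weights. The machine has read-only access to the number of
  vertices and to the edge currently at the head of the stream (\<open>InU\<close>, \<open>InV\<close>, \<open>InW\<close>), but not
  to any other part of the stream.

  Weights are arbitrary non-negative reals, so a weight has no bit length of its own; as usual, a
  stored weight is charged as one machine word. To make this charge harmless, the only values that
  can ever be written to a weight cell are copies of weights from the stream: arithmetic on
  weights is available inside comparisons, but its results cannot be stored. Thus reals cannot be
  used to pack further information into a cell. The constants in programs are rational for the
  same reason.
\<close>

datatype aexp =
    Const nat
  | NumVertices
  | InU
  | InV
  | Mem aexp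
  | Plus aexp aexp
  | Minus aexp aexp
  | Times aexp aexp
  | Div aexp aexp
  | Mod aexp aexp

datatype wsource = InW | WMem aexp

datatype wexp =
    WConst rat
  | WVal wsource
  | WOfNat aexp
  | WPlus wexp wexp
  | WMinus wexp wexp
  | WTimes wexp wexp

datatype bexp =
    Less aexp aexp
  | WLess wexp wexp
  | Not bexp
  | And bexp bexp

datatype com =
    Skip
  | Store aexp aexp
  | WStore aexp wsource
  | Emit aexp aexp
  | Seq com com
  | If bexp com com
  | While bexp com

record input =
  num_vertices :: nat
  in_u :: nat
  in_v :: nat
  in_w :: real

text \<open>The field \<open>out_tape\<close> is a write-only tape and not part of the working memory.\<close>

record state =
  mem :: "nat \<Rightarrow> nat"
  wmem :: "nat \<Rightarrow> real"
  out_tape :: "(nat \<times> nat) list"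

record limits =
  mem_size :: nat
  wmem_size :: nat
  word_bits :: nat

fun aval :: "input \<Rightarrow> state \<Rightarrow> aexp \<Rightarrow> nat" where
  "aval i s (Const k) = k"
| "aval i s NumVertices = num_vertices i"
| "aval i s InU = in_u i"
| "aval i s InV = in_v i"
| "aval i s (Mem a) = mem s (aval i s a)"
| "aval i s (Plus a b) = aval i s a + aval i s b"
| "aval i s (Minus a b) = aval i s a - aval i s b"
| "aval i s (Times a b) = aval i s a * aval i s b"
| "aval i s (Div a b) = aval i s a div aval i s b"
| "aval i s (Mod a b) = aval i s a mod aval i s b"

fun wsval :: "input \<Rightarrow> state \<Rightarrow> wsource \<Rightarrow> real" where
  "wsval i s InW = in_w i"
| "wsval i s (WMem a) = wmem s (aval i s a)"

fun wval :: "input \<Rightarrow> state \<Rightarrow> wexp \<Rightarrow> real" where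
  "wval i s (WConst q) = of_rat q"
| "wval i s (WVal x) = wsval i s x"
| "wval i s (WOfNat a) = real (aval i s a)"
| "wval i s (WPlus x y) = wval i s x + wval i s y"
| "wval i s (WMinus x y) = wval i s x - wval i s y"
| "wval i s (WTimes x y) = wval i s x * wval i s y"

fun bval :: "input \<Rightarrow> state \<Rightarrow> bexp \<Rightarrow> bool" where
  "bval i s (Less a b) \<longleftrightarrow> aval i s a < aval i s b"
| "bval i s (WLess x y) \<longleftrightarrow> wval i s x < wval i s y"
| "bval i s (Not b) \<longleftrightarrow> \<not> bval i s b"
| "bval i s (And b c) \<longleftrightarrow> bval i s b \<and> bval i s c"

text \<open>
  \<open>exec L i c s t s'\<close>: on input \<open>i\<close>, command \<open>c\<close> takes state \<open>s\<close> to state \<open>s'\<close> in time \<open>t\<close>. Every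
  elementary command and every test costs one unit; the expressions in a fixed program have
  constant size. There is no transition, hence no run at all, if a command writes outside the
  memory limits \<open>L\<close> or writes a number that does not fit into a word; cells outside the limits
  are never written and so carry no information.
\<close>

inductive exec :: "limits \<Rightarrow> input \<Rightarrow> com \<Rightarrow> state \<Rightarrow> nat \<Rightarrow> state \<Rightarrow> bool"
  for L :: limits and i :: input where
  Skip: "exec L i Skip s 1 s"
| Store: "\<lbrakk>aval i s a < mem_size L; aval i s b < 2 ^ word_bits L\<rbrakk> \<Longrightarrow>
    exec L i (Store a b) s 1 (s\<lparr>mem := (mem s)(aval i s a := aval i s b)\<rparr>)"
| WStore: "aval i s a < wmem_size L \<Longrightarrow>
    exec L i (WStore a x) s 1 (s\<lparr>wmem := (wmem s)(aval i s a := wsval i s x)\<rparr>)"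
| Emit: "exec L i (Emit a b) s 1 (s\<lparr>out_tape := out_tape s @ [(aval i s a, aval i s b)]\<rparr>)"
| Seq: "\<lbrakk>exec L i c s t s'; exec L i d s' t' s''\<rbrakk> \<Longrightarrow> exec L i (Seq c d) s (t + t') s''"
| IfTrue: "\<lbrakk>bval i s b; exec L i c s t s'\<rbrakk> \<Longrightarrow> exec L i (If b c d) s (Suc t) s'"
| IfFalse: "\<lbrakk>\<not> bval i s b; exec L i d s t s'\<rbrakk> \<Longrightarrow> exec L i (If b c d) s (Suc t) s'"
| WhileFalse: "\<not> bval i s b \<Longrightarrow> exec L i (While b c) s 1 s"
| WhileTrue: "\<lbrakk>bval i s b; exec L i c s t s'; exec L i (While b c) s' t' s''\<rbrakk> \<Longrightarrow>
    exec L i (While b c) s (Suc (t + t')) s''"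

inductive_cases SkipE: "exec L i Skip s t s'"
inductive_cases StoreE: "exec L i (Store a b) s t s'"
inductive_cases WStoreE: "exec L i (WStore a x) s t s'"
inductive_cases EmitE: "exec L i (Emit a b) s t s'"
inductive_cases SeqE: "exec L i (Seq c d) s t s'"
inductive_cases IfE: "exec L i (If b c d) s t s'"
inductive_cases WhileE: "exec L i (While b c) s t s'"

lemma exec_deterministic:
  "exec L i c s t s' \<Longrightarrow> exec L i c s u s'' \<Longrightarrow> u = t \<and> s'' = s'"
proof (induction arbitrary: u s'' rule: exec.induct)
  case (Seq c s t s' d t' s2)
  from Seq.prems show ?case by (rule SeqE) (use Seq.IH in blast)
next
  case (IfTrue s b c t s' d)
  from IfTrue.prems show ?case by (rule IfE) (use IfTrue.IH IfTrue.hyps in blast)+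
next
  case (IfFalse s b d t s' c)
  from IfFalse.prems show ?case by (rule IfE) (use IfFalse.IH IfFalse.hyps in blast)+
next
  case (WhileFalse s b c)
  from WhileFalse.prems show ?case by (rule WhileE) (use WhileFalse.hyps in simp_all)
next
  case (WhileTrue s b c t s' t' s2)
  from WhileTrue.prems show ?case by (rule WhileE) (use WhileTrue.IH WhileTrue.hyps in blast)+
qed (auto elim: SkipE StoreE WStoreE EmitE)

section \<open>One-pass streaming algorithms\<close>

text \<open>
  An algorithm consists of a program that is run once for each edge of the stream, a program that
  is run after the end of the stream, and the memory limits under which it is run on graphs with
  \<open>n\<close> vertices. The programs do not depend on \<open>n\<close>.
\<close>

record stream_alg =
  edge_prog :: com
  final_prog :: com
  resources :: "nat \<Rightarrow> limits"

definition initial_state :: state where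
  "initial_state = \<lparr>mem = (\<lambda>_. 0), wmem = (\<lambda>_. 0), out_tape = []\<rparr>"

abbreviation edge_of :: "nat \<times> nat \<Rightarrow> nat set" where
  "edge_of p \<equiv> {fst p, snd p}"

text \<open>The list of numbers in \<open>process\<close> records the time spent on each edge.\<close>

inductive process ::
  "stream_alg \<Rightarrow> nat \<Rightarrow> (nat set \<Rightarrow> real) \<Rightarrow> state \<Rightarrow> (nat \<times> nat) list \<Rightarrow> nat list \<Rightarrow> state \<Rightarrow> bool"
  for A :: stream_alg and n :: nat and w :: "nat set \<Rightarrow> real" where
  Nil: "process A n w s [] [] s"
| Cons: "\<lbrakk>exec (resources A n) \<lparr>num_vertices = n, in_u = u, in_v = v, in_w = w {u, v}\<rparr>
      (edge_prog A) s t s'; process A n w s' xs ts s''\<rbrakk> \<Longrightarrow>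
    process A n w s ((u, v) # xs) (t # ts) s''"

definition run ::
  "stream_alg \<Rightarrow> nat \<Rightarrow> (nat set \<Rightarrow> real) \<Rightarrow> (nat \<times> nat) list \<Rightarrow> nat list \<Rightarrow> nat \<Rightarrow> nat set set \<Rightarrow> bool"
  where
  "run A n w xs ts t M \<longleftrightarrow> (\<exists>s s'. process A n w initial_state xs ts s \<and>
     exec (resources A n) \<lparr>num_vertices = n, in_u = 0, in_v = 0, in_w = 0\<rparr> (final_prog A) s t s' \<and>
     M = edge_of ` set (out_tape s'))"

text \<open>
  The edges arrive in arbitrary order, each exactly once, and with its endpoints listed in
  arbitrary order.
\<close>

definition weighted_graph_stream ::
  "nat \<Rightarrow> nat set set \<Rightarrow> (nat set \<Rightarrow> real) \<Rightarrow> (nat \<times> nat) list \<Rightarrow> bool" where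
  "weighted_graph_stream n E w xs \<longleftrightarrow> simple_graph n E \<and> (\<forall>e\<in>E. 0 \<le> w e) \<and>
     distinct (map edge_of xs) \<and> set (map edge_of xs) = E"

definition approximation_algorithm :: "real \<Rightarrow> stream_alg \<Rightarrow> bool" where
  "approximation_algorithm \<rho> A \<longleftrightarrow> (\<forall>n E w xs. weighted_graph_stream n E w xs \<longrightarrow>
     (\<exists>ts t M. run A n w xs ts t M \<and> matching E M \<and> max_matching_weight E w \<le> \<rho> * weight w M))"

definition space_bits :: "stream_alg \<Rightarrow> nat \<Rightarrow> nat" where
  "space_bits A n =
     (mem_size (resources A n) + wmem_size (resources A n)) * word_bits (resources A n)"

text \<open>The bound on the word length is what makes it legitimate to count a word operation as one
  unit of time.\<close>

definition semi_streaming :: "stream_alg \<Rightarrow> bool" where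
  "semi_streaming A \<longleftrightarrow>
     (\<lambda>n. real (word_bits (resources A n))) \<in> O(\<lambda>n. ln (real n)) \<and>
     (\<exists>k::nat. (\<lambda>n. real (space_bits A n)) \<in> O(\<lambda>n. real n * ln (real n) ^ k))"

definition constant_time_per_edge :: "stream_alg \<Rightarrow> bool" where
  "constant_time_per_edge A \<longleftrightarrow> (\<exists>c. \<forall>n E w xs ts t M.
     weighted_graph_stream n E w xs \<longrightarrow> run A n w xs ts t M \<longrightarrow> (\<forall>t'\<in>set ts. t' \<le> c))"

definition linear_final_time :: "stream_alg \<Rightarrow> bool" where
  "linear_final_time A \<longleftrightarrow> (\<exists>T :: nat \<Rightarrow> nat. (\<lambda>n. real (T n)) \<in> O(\<lambda>n. real n) \<and>
     (\<forall>n E w xs ts t M.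
        weighted_graph_stream n E w xs \<longrightarrow> run A n w xs ts t M \<longrightarrow> t \<le> T n))"

end

theory Submission
  imports Defs "HOL-Library.Log_Nat"
begin

text \<open>
  The algorithm is the local ratio method of Paz and Schwartzman with the space reduction of
  Ghaffari and Wajc, for fixed constants that give the ratio 4.8. Vertices carry potentials \<open>p\<close>.
  An edge \<open>{u, v}\<close> of weight \<open>w > 2 (p u + p v)\<close> is pushed: \<open>p u\<close> becomes \<open>w - p v\<close> and \<open>p v\<close>
  becomes \<open>w - p u\<close>. In the end \<open>2 p\<close> is a fractional vertex cover, and taking pushed edges
  greedily, newest first, gives a matching \<open>M\<close> whose weight is at least half of the sum of \<open>p\<close>,
  since the rise of \<open>p u\<close> caused by a pushed edge is charged to the later edge of \<open>M\<close> that blocks it.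

  Each push at least doubles the potential of its endpoints, so it is harmless to remember only the
  newest four pushes at each vertex: the earlier ones account for at most \<open>1/16\<close> of \<open>p\<close>. As
  sums of weights cannot be stored, \<open>p u\<close> is rounded up to a multiple of \<open>w/16\<close>, where \<open>w\<close> is the
  weight of the last edge pushed at \<open>u\<close>; the ratio becomes \<open>2 (16/15) (2 + 4/16) = 4.8\<close>.
\<close>

section \<open>Local ratio matching with bounded buffers\<close>

fun greedy :: "'a set \<Rightarrow> ('a \<times> 'a) list \<Rightarrow> ('a \<times> 'a) list" where
  "greedy B [] = []"
| "greedy B ((x, y) # ps) =
     (if x \<in> B \<or> y \<in> B then greedy B ps else (x, y) # greedy (insert x (insert y B)) ps)"

lemma greedy_subset: "h \<in> set (greedy B ps) \<Longrightarrow> h \<in> set ps \<and> fst h \<notin> B \<and> snd h \<notin> B"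
  by (induction B ps rule: greedy.induct) (auto split: if_splits)

lemma greedy_disjoint:
  "e \<in> edge_of ` set (greedy B ps) \<Longrightarrow> f \<in> edge_of ` set (greedy B ps) \<Longrightarrow> e \<noteq> f \<Longrightarrow> e \<inter> f = {}"
proof (induction B ps arbitrary: e f rule: greedy.induct)
  case (2 B x y ps)
  show ?case
  proof (cases "x \<in> B \<or> y \<in> B")
    case True
    then show ?thesis using 2 by simp
  next
    case False
    have *: "{x, y} \<inter> g = {}" if "g \<in> edge_of ` set (greedy (insert x (insert y B)) ps)" for g
      using that greedy_subset[of _ "insert x (insert y B)" ps] by fastforce
    from False "2.prems"(1,2) have
      "e = {x, y} \<or> e \<in> edge_of ` set (greedy (insert x (insert y B)) ps)"
      "f = {x, y} \<or> f \<in> edge_of ` set (greedy (insert x (insert y B)) ps)" by simp_all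
    then show ?thesis
      using "2.prems"(3) "2.IH"(2)[OF False, of e f] *[of e] *[of f] by blast
  qed
qed simp

text \<open>Edges accepted later avoid the endpoints of those accepted before, so no edge occurs
  twice and the set has the weight of the list.\<close>

lemma weight_greedy:
  "weight w (edge_of ` set (greedy B ps)) = sum_list (map (w \<circ> edge_of) (greedy B ps))"
proof (induction B ps rule: greedy.induct)
  case (2 B x y ps)
  have "{x, y} \<notin> edge_of ` set (greedy (insert x (insert y B)) ps)"
    using greedy_subset[of _ "insert x (insert y B)" ps] by fastforce
  then show ?case using 2 by (auto simp: weight_def)
qed (simp add: weight_def)

section \<open>Ring buffers for the newest pushes at each vertex\<close>

definition pushes :: "('a \<times> 'b) list \<Rightarrow> 'a \<Rightarrow> nat" where
  "pushes hs x = length (filter (\<lambda>h. fst h = x) hs)"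

lemma pushes_simps [simp]:
  "pushes [] x = 0"
  "pushes ((z, y) # hs) x = (if z = x then Suc (pushes hs x) else pushes hs x)"
  by (simp_all add: pushes_def)

text \<open>Slot of push number \<open>i\<close> (counted from 0) in the ring buffer of
  \<open>x\<close>, which owns \<open>K\<close> consecutive numbers. The \<open>Suc\<close> keeps 0
  free for the sentinel of the linked list.\<close>

definition node :: "nat \<Rightarrow> nat \<Rightarrow> nat \<Rightarrow> nat" where
  "node K x i = Suc (K * x + i mod K)"

text \<open>Pushes are listed newest first. A push at \<open>x\<close> evicts the entry that shares
  its slot, if there is one; the other entries keep their order.\<close>

fun buffer :: "nat \<Rightarrow> (nat \<times> 'a) list \<Rightarrow> (nat \<times> 'a) list" where
  "buffer K [] = []"
| "buffer K ((x, y) # hs) =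
     (node K x (pushes hs x), y) # filter (\<lambda>h. fst h \<noteq> node K x (pushes hs x)) (buffer K hs)"

text \<open>The part of \<open>buffer\<close> that survives \<open>c x\<close> further pushes at each vertex \<open>x\<close>.\<close>

fun live :: "nat \<Rightarrow> (nat \<Rightarrow> nat) \<Rightarrow> (nat \<times> 'a) list \<Rightarrow> (nat \<times> 'a) list" where
  "live K c [] = []"
| "live K c ((x, y) # hs) = (if c x < K then [(node K x (pushes hs x), y)] else []) @
     live K (c(x := Suc (c x))) hs"

lemma node_owner [simp]: "K > 0 \<Longrightarrow> (node K x i - Suc 0) div K = x"
  by (simp add: node_def)

lemma node_inj: "K > 0 \<Longrightarrow> node K x i = node K y j \<longleftrightarrow> x = y \<and> i mod K = j mod K"
  by (metis add_left_cancel nat.inject node_def node_owner)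

text \<open>After \<open>K\<close> newer pushes at \<open>x\<close> nothing pushed at
  \<open>x\<close> survives, so a higher count changes nothing.\<close>

lemma live_full:
  assumes "K > 0" "K \<le> c x"
  shows "live K (c(x := Suc (c x))) hs = live K c hs \<and> (\<forall>i. node K x i \<notin> fst ` set (live K c hs))"
  using assms(2)
proof (induction hs arbitrary: c)
  case (Cons h hs)
  obtain z y where h: "h = (z, y)" by fastforce
  show ?case
  proof (cases "z = x")
    case True
    then show ?thesis using Cons.IH[of "c(x := Suc (c x))"] Cons.prems h
      by (simp add: fun_upd_same del: fun_upd_apply)
  next
    case False
    have "c(x := Suc (c x), z := Suc (c z)) = c(z := Suc (c z), x := Suc (c x))"
      using False by (rule fun_upd_twist[OF not_sym])
    then show ?thesis
      using Cons.IH[of "c(z := Suc (c z))"] Cons.prems h False assms(1)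
      by (auto simp: node_inj fun_upd_same fun_upd_other simp del: fun_upd_apply)
  qed
qed simp

text \<open>One more newer push at \<open>x\<close> can only evict the entry at \<open>x\<close>
  that has exactly \<open>K - 1\<close> newer ones. The evicting push has number
  \<open>pushes hs x + c x\<close>, which exceeds the number of that entry by \<open>K\<close>, so
  both have the same slot.\<close>

lemma live_Suc:
  assumes "c x < K"
  shows "live K (c(x := Suc (c x))) hs =
    filter (\<lambda>h. fst h \<noteq> node K x (pushes hs x + c x)) (live K c hs)"
  using assms
proof (induction hs arbitrary: c)
  case (Cons h hs)
  obtain z y where h: "h = (z, y)" by fastforce
  have K: "K > 0" using Cons.prems by simp
  show ?case
  proof (cases "z = x")
    case False
    have "c(x := Suc (c x), z := Suc (c z)) = c(z := Suc (c z), x := Suc (c x))"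
      using False by (rule fun_upd_twist[OF not_sym])
    then show ?thesis
      using Cons.IH[of "c(z := Suc (c z))"] Cons.prems h False K
      by (simp add: node_inj fun_upd_same fun_upd_other del: fun_upd_apply)
  next
    case True
    show ?thesis
    proof (cases "Suc (c x) < K")
      case Suc: True
      \<comment> \<open>The head entry survives: its number and that of the evicting push differ by
        \<open>Suc (c x)\<close>, which lies strictly between 0 and \<open>K\<close>.\<close>
      have "pushes hs x mod K \<noteq> Suc (pushes hs x + c x) mod K"
      proof
        assume "pushes hs x mod K = Suc (pushes hs x + c x) mod K"
        then have "K dvd Suc (pushes hs x + c x) - pushes hs x"
          by (metis mod_eq_dvd_iff_nat le_SucI le_add1)
        then show False using Suc by (simp add: nat_dvd_not_less)
      qed
      then show ?thesis
        using Cons.IH[of "c(x := Suc (c x))"] Suc True h K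
        by (simp add: node_inj fun_upd_same del: fun_upd_apply)
    next
      case False
      \<comment> \<open>Boundary case: the head is the evicted entry, and older entries at
        \<open>x\<close> are already gone by \<open>live_full\<close>.\<close>
      then have cx: "Suc (c x) = K" using Cons.prems by simp
      have full: "live K (c(x := Suc K)) hs = live K (c(x := K)) hs"
        "\<forall>i. node K x i \<notin> fst ` set (live K (c(x := K)) hs)"
        using live_full[of K "c(x := K)" x hs] K by simp_all
      have "Suc (pushes hs x + c x) mod K = pushes hs x mod K"
        using cx by (metis add_Suc_right mod_add_self2)
      then have "node K x (Suc (pushes hs x + c x)) = node K x (pushes hs x)"
        by (simp add: node_def)
      moreover have "filter (\<lambda>h. fst h \<noteq> node K x (pushes hs x)) (live K (c(x := K)) hs)
        = live K (c(x := K)) hs"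
        using full(2) by (force simp: filter_id_conv)
      ultimately show ?thesis using cx full(1) True h Cons.prems
        by (simp add: fun_upd_same del: fun_upd_apply)
    qed
  qed
qed simp

text \<open>\<open>buffer\<close> is what the memory maintains; \<open>live\<close> carries its
  counts down the list and thus suits an induction that peels off the newest edge.\<close>

lemma buffer_live: "K > 0 \<Longrightarrow> buffer K hs = live K (\<lambda>_. 0) hs"
proof (induction hs)
  case (Cons h hs)
  then show ?case using live_Suc[of "\<lambda>_. 0" "fst h" K hs] by (cases h) simp
qed simp

lemma buffer_set: "h \<in> set (buffer K hs) \<Longrightarrow> \<exists>x i. (x, snd h) \<in> set hs \<and> fst h = node K x i"
  by (induction K hs rule: buffer.induct) fastforce+

lemma distinct_buffer: "distinct (map fst (buffer K hs))"
proof (induction K hs rule: buffer.induct)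
  case (2 K x y hs)
  then show ?case by (auto simp: distinct_map_filter)
qed simp

section \<open>Local ratio runs and the weight of the resulting matching\<close>

fun halves :: "('a \<times> 'a) list \<Rightarrow> ('a \<times> 'a) list" where
  "halves [] = []"
| "halves ((u, v) # es) = (v, u) # (u, v) # halves es"

lemma set_halves: "set (halves es) = set es \<union> prod.swap ` set es"
  by (induction es rule: halves.induct) auto

text \<open>Runs of the local ratio algorithm in which potentials may be rounded up by at most \<open>\<eta>\<close> times
  the weight of the edge; the newest edge comes first.\<close>

inductive history :: "(nat set \<Rightarrow> real) \<Rightarrow> nat \<Rightarrow> real \<Rightarrow> (nat \<Rightarrow> real) \<Rightarrow> (nat \<times> nat) list \<Rightarrow> bool"
  for w n \<eta> where
  Nil: "history w n \<eta> (\<lambda>_. 0) []"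
| Push: "\<lbrakk>history w n \<eta> p es; u < n; v < n; u \<noteq> v; 2 * (p u + p v) < w {u, v};
    w {u, v} - p v \<le> a; a \<le> w {u, v} - p v + \<eta> * w {u, v};
    w {u, v} - p u \<le> b; b \<le> w {u, v} - p u + \<eta> * w {u, v}\<rbrakk> \<Longrightarrow>
    history w n \<eta> (p(u := a, v := b)) ((u, v) # es)"

lemma history_nonneg: "history w n \<eta> p es \<Longrightarrow> 0 \<le> p x"
proof (induction arbitrary: x rule: history.induct)
  case (Push p es u v a b)
  have "0 \<le> a" using Push.hyps(5,6) Push.IH[of u] Push.IH[of v] by simp
  moreover have "0 \<le> b" using Push.hyps(5,8) Push.IH[of u] Push.IH[of v] by simp
  ultimately show ?case using Push.IH by simp
qed simp

abbreviation half_edges :: "nat \<Rightarrow> (nat \<times> 'a) list \<Rightarrow> (nat \<times> 'a) list" where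
  "half_edges K \<equiv> map (\<lambda>h. ((fst h - 1) div K, snd h))"

text \<open>Share of the potential that is surely due to the newest \<open>K - k\<close> pushes at a
  vertex, the ones kept after \<open>k\<close> further pushes. Truncated subtraction makes it 0 for
  \<open>k \<ge> K\<close>.\<close>

abbreviation "buffered K k \<equiv> 1 - (1/2 :: real) ^ (K - k)"

text \<open>For \<open>k < K\<close> the claim reduces to the doubling
  \<open>2 * p \<le> p'\<close>, weighted with a power of 1/2; otherwise both sides vanish.\<close>

lemma buffered_step:
  assumes "2 * p \<le> p'" "0 \<le> p"
  shows "buffered K k * p' \<le> buffered K (Suc k) * p + (if k < K then p' - p else 0)"
proof (cases "k < K")
  case True
  then obtain d where d: "K - k = Suc d" "K - Suc k = d"
    by (metis Suc_diff_Suc)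
  have "(1/2::real) ^ d * (2 * p) \<le> (1/2) ^ d * p'" using assms by (intro mult_left_mono) auto
  then show ?thesis using True d by (simp add: algebra_simps)
qed simp

text \<open>Induction that removes the newest edge. The greedy run on the older edges then starts
  with some blocked vertices \<open>B\<close> and some counts \<open>c\<close> of newer pushes,
  hence both are arbitrary. The term with \<open>B\<close> collects what has been charged to newer
  matching edges at blocked vertices.\<close>

lemma history_bound:
  assumes "history w n \<eta> p es" "K > 0" "0 \<le> \<eta>" "finite B"
  shows "(\<Sum>x<n. buffered K (c x) * p x) \<le> (2 + 2 * \<eta>) * (\<Sum>x\<in>B. p x) + (2 + 4 * \<eta>) *
    sum_list (map (w \<circ> edge_of) (greedy B (half_edges K (live K c (halves es)))))"
  using assms(1,4)
proof (induction arbitrary: B c rule: history.induct)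
  case (Push p es u v a b)
  define W where "W = w {u, v}"
  define c1 where "c1 = c(v := Suc (c v), u := Suc (c u))"
  define p1 where "p1 = p(u := a, v := b)"
  define gu where "gu = a - p u"
  define gv where "gv = b - p v"
  \<comment> \<open>The rises \<open>gu\<close> and \<open>gv\<close> count only where the half-edge
    is still kept.\<close>
  define G where "G = (if c u < K then gu else 0) + (if c v < K then gv else 0)"
  define ps where "ps = half_edges K (live K c1 (halves es))"
  define R where "R B = sum_list (map (w \<circ> edge_of) (greedy B ps))" for B
  have nonneg: "0 \<le> p x" for x using history_nonneg Push.hyps(1) by blast
  have W: "2 * (p u + p v) < W" "W - p v \<le> a" "a \<le> W - p v + \<eta> * W"
    "W - p u \<le> b" "b \<le> W - p u + \<eta> * W" using Push.hyps by (simp_all add: W_def)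
  have pos: "0 < gu" "0 < gv" using W nonneg[of u] nonneg[of v] by (simp_all add: gu_def gv_def)
  have half: "W \<le> 2 * gu" "W \<le> 2 * gv" using W by (simp_all add: gu_def gv_def)
  have double: "2 * p u \<le> a" "2 * p v \<le> b" using W nonneg[of u] nonneg[of v] by simp_all
  have uv: "u \<noteq> v" by fact
  have point: "buffered K (c x) * p1 x \<le> buffered K (c1 x) * p x
      + (if x = u then (if c u < K then gu else 0) else 0)
      + (if x = v then (if c v < K then gv else 0) else 0)" for x
    using buffered_step[OF double(1) nonneg, of K "c u"] buffered_step[OF double(2) nonneg, of K "c v"]
    using uv by (auto simp: p1_def c1_def gu_def gv_def)
  have "(\<Sum>x<n. buffered K (c x) * p1 x) \<le> (\<Sum>x<n. buffered K (c1 x) * p x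
      + (if x = u then (if c u < K then gu else 0) else 0)
      + (if x = v then (if c v < K then gv else 0) else 0))"
    by (intro sum_mono point)
  also have "\<dots> = (\<Sum>x<n. buffered K (c1 x) * p x) + G"
    using Push.hyps by (simp add: sum.distrib G_def)
  finally have lhs: "(\<Sum>x<n. buffered K (c x) * p1 x) \<le> (\<Sum>x<n. buffered K (c1 x) * p x) + G" .
  have IH: "(\<Sum>x<n. buffered K (c1 x) * p x) \<le> (2 + 2 * \<eta>) * (\<Sum>x\<in>B. p x) + (2 + 4 * \<eta>) * R B"
    if "finite B" for B unfolding R_def ps_def by (rule Push.IH) (fact that)
  \<comment> \<open>The edge is listed once for each endpoint whose buffer still holds it. If the
    first copy is taken, it blocks the second, so \<open>W\<close> is counted at most once.\<close>
  have gr: "sum_list (map (w \<circ> edge_of) (greedy B (half_edges K (live K c (halves ((u, v) # es)))))) =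
    (if (c u < K \<or> c v < K) \<and> u \<notin> B \<and> v \<notin> B then W + R (insert u (insert v B)) else R B)"
  proof -
    have "half_edges K (live K c (halves ((u, v) # es))) =
      (if c v < K then [(v, u)] else []) @ (if c u < K then [(u, v)] else []) @ ps"
      using uv \<open>K > 0\<close>
      by (simp add: c1_def ps_def fun_upd_same fun_upd_other del: fun_upd_apply)
    moreover have "sum_list (map (w \<circ> edge_of) (greedy B
        ((if c v < K then [(v, u)] else []) @ (if c u < K then [(u, v)] else []) @ ps))) =
      (if (c u < K \<or> c v < K) \<and> u \<notin> B \<and> v \<notin> B then W + R (insert u (insert v B)) else R B)"
      by (cases "c v < K"; cases "c u < K"; cases "u \<in> B"; cases "v \<in> B")
        (simp_all add: R_def W_def insert_commute)
    ultimately show ?thesis by simp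
  qed
  have G: "G \<le> gu + gv" using pos by (simp add: G_def)
  \<comment> \<open>Both rises lie between \<open>W - p u - p v\<close>, which exceeds
    \<open>W/2\<close>, and this value plus \<open>\<eta> * W\<close>. So each is at most
    \<open>1 + 2 * \<eta>\<close> times the other.\<close>
  have "\<eta> * W \<le> \<eta> * (2 * gu)" "\<eta> * W \<le> \<eta> * (2 * gv)"
    using half \<open>0 \<le> \<eta>\<close> by (simp_all add: mult_left_mono)
  moreover have "gv \<le> gu + \<eta> * W" "gu \<le> gv + \<eta> * W" using W unfolding gu_def gv_def by linarith+
  ultimately have bal: "gu + gv \<le> (2 + 2 * \<eta>) * gu" "gu + gv \<le> (2 + 2 * \<eta>) * gv"
    unfolding distrib_right by linarith+
  have sumB: "(\<Sum>x\<in>B. p1 x) = (\<Sum>x\<in>B. p x) + (if u \<in> B then gu else 0) + (if v \<in> B then gv else 0)"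
  proof -
    have "(\<Sum>x\<in>B. p1 x) = (\<Sum>x\<in>B. p x + (if x = u then gu else 0) + (if x = v then gv else 0))"
      using uv by (intro sum.cong) (auto simp: p1_def gu_def gv_def)
    then show ?thesis using Push.prems by (simp add: sum.distrib)
  qed
  have mono: "(2 + 2 * \<eta>) * (\<Sum>x\<in>B. p x) \<le> (2 + 2 * \<eta>) * (\<Sum>x\<in>B. p1 x)"
    unfolding sumB using pos \<open>0 \<le> \<eta>\<close> by (intro mult_left_mono) auto
  show ?case unfolding p1_def[symmetric] gr
  proof (cases "(c u < K \<or> c v < K) \<and> u \<notin> B \<and> v \<notin> B")
    case True
    have "(\<Sum>x\<in>insert u (insert v B). p x) = p u + p v + (\<Sum>x\<in>B. p x)"
      using True uv Push.prems by simp
    then have "(\<Sum>x<n. buffered K (c1 x) * p x) \<le>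
      (2 + 2 * \<eta>) * (p u + p v + (\<Sum>x\<in>B. p x)) + (2 + 4 * \<eta>) * R (insert u (insert v B))"
      using IH[of "insert u (insert v B)"] Push.prems by simp
    \<comment> \<open>The edge joins the matching: \<open>W\<close> pays for both rises and for the
      old potentials of \<open>u\<close> and \<open>v\<close>, which the induction hypothesis
      charges once these are blocked.\<close>
    moreover have "(2 + 2 * \<eta>) * (p u + p v) + (gu + gv) \<le> (2 + 4 * \<eta>) * W"
    proof -
      have "gu + gv \<le> 2 * (W - p u - p v) + 2 * (\<eta> * W)" using W by (simp add: gu_def gv_def)
      moreover have "\<eta> * (p u + p v) \<le> \<eta> * W"
        using W nonneg[of u] nonneg[of v] \<open>0 \<le> \<eta>\<close> by (intro mult_left_mono) auto
      ultimately show ?thesis by (simp add: algebra_simps)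
    qed
    ultimately show "(\<Sum>x<n. buffered K (c x) * p1 x) \<le> (2 + 2 * \<eta>) * (\<Sum>x\<in>B. p1 x) + (2 + 4 * \<eta>) *
      (if (c u < K \<or> c v < K) \<and> u \<notin> B \<and> v \<notin> B then W + R (insert u (insert v B)) else R B)"
      using lhs G mono True by (simp add: algebra_simps)
  next
    case False
    \<comment> \<open>If an endpoint is blocked, the rise there pays for both rises. Otherwise no
      half of the edge is kept and \<open>G\<close> is 0.\<close>
    have "G \<le> (2 + 2 * \<eta>) * ((if u \<in> B then gu else 0) + (if v \<in> B then gv else 0))"
    proof (cases "u \<in> B \<or> v \<in> B")
      case True
      have "0 \<le> (2 + 2 * \<eta>) * gu" "0 \<le> (2 + 2 * \<eta>) * gv" using pos \<open>0 \<le> \<eta>\<close> by simp_all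
      then show ?thesis using True G bal by (auto simp: distrib_left)
    qed (use False in \<open>simp add: G_def\<close>)
    then have "(2 + 2 * \<eta>) * (\<Sum>x\<in>B. p x) + G \<le> (2 + 2 * \<eta>) * (\<Sum>x\<in>B. p1 x)"
      unfolding sumB by (simp add: algebra_simps)
    then show "(\<Sum>x<n. buffered K (c x) * p1 x) \<le> (2 + 2 * \<eta>) * (\<Sum>x\<in>B. p1 x) + (2 + 4 * \<eta>) *
      (if (c u < K \<or> c v < K) \<and> u \<notin> B \<and> v \<notin> B then W + R (insert u (insert v B)) else R B)"
      using lhs IH[OF Push.prems] False by (simp only: if_not_P if_False)
  qed
qed simp

text \<open>Weak duality: \<open>2 * p\<close> is a fractional vertex cover, and since matching
  edges are disjoint, each vertex pays at most once.\<close>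

lemma weight_le_potential:
  assumes "simple_graph n E" "matching E M" "\<And>x. 0 \<le> p x"
    and cover: "\<And>u v. {u, v} \<in> E \<Longrightarrow> u \<noteq> v \<Longrightarrow> w {u, v} \<le> 2 * (p u + p v)"
  shows "weight w M \<le> 2 * (\<Sum>x<n. p x)"
proof -
  have M: "\<exists>u v. e = {u, v} \<and> u < n \<and> v < n \<and> u \<noteq> v \<and> e \<in> E" if "e \<in> M" for e
  proof -
    have "e \<in> E" using that assms(2) by (auto simp: matching_def)
    moreover from this have "e \<in> {{u, v} | u v. u < n \<and> v < n \<and> u \<noteq> v}"
      using assms(1) unfolding simple_graph_def by (rule subsetD[rotated])
    ultimately show ?thesis by simp
  qed
  have "weight w M \<le> (\<Sum>e\<in>M. 2 * (\<Sum>x\<in>e. p x))"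
    unfolding weight_def
  proof (rule sum_mono)
    fix e assume "e \<in> M"
    then obtain u v where "e = {u, v}" "u \<noteq> v" "{u, v} \<in> E" using M[of e] by auto
    then show "w e \<le> 2 * (\<Sum>x\<in>e. p x)" using cover[of u v] by simp
  qed
  also have "\<dots> = 2 * (\<Sum>x\<in>\<Union>M. p x)"
  proof -
    have "finite e" if "e \<in> M" for e using M[OF that] by auto
    moreover have "\<forall>e\<in>M. \<forall>f\<in>M. e \<noteq> f \<longrightarrow> e \<inter> f = {}"
      using assms(2) by (simp add: matching_def)
    ultimately show ?thesis by (simp add: sum.Union_disjoint flip: sum_distrib_left)
  qed
  also have "(\<Sum>x\<in>\<Union>M. p x) \<le> (\<Sum>x<n. p x)"
  proof (rule sum_mono2)
    show "\<Union>M \<subseteq> {..<n}"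
    proof
      fix x assume "x \<in> \<Union>M"
      then obtain e where "e \<in> M" "x \<in> e" by blast
      then show "x \<in> {..<n}" using M[of e] by auto
    qed
  qed (use assms(3) in auto)
  finally show ?thesis by simp
qed

section \<open>Programs\<close>

primrec loop_free :: "com \<Rightarrow> bool" where
  "loop_free Skip \<longleftrightarrow> True"
| "loop_free (Store a b) \<longleftrightarrow> True"
| "loop_free (WStore a x) \<longleftrightarrow> True"
| "loop_free (Emit a b) \<longleftrightarrow> True"
| "loop_free (Seq c d) \<longleftrightarrow> loop_free c \<and> loop_free d"
| "loop_free (If b c d) \<longleftrightarrow> loop_free c \<and> loop_free d"
| "loop_free (While b c) \<longleftrightarrow> False"

primrec max_time :: "com \<Rightarrow> nat" where
  "max_time Skip = 1"
| "max_time (Store a b) = 1"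
| "max_time (WStore a x) = 1"
| "max_time (Emit a b) = 1"
| "max_time (Seq c d) = max_time c + max_time d"
| "max_time (If b c d) = Suc (max (max_time c) (max_time d))"
| "max_time (While b c) = 0"

lemma exec_max_time: "exec L i c s t s' \<Longrightarrow> loop_free c \<Longrightarrow> t \<le> max_time c"
  by (induction rule: exec.induct) auto

text \<open>Total correctness: memory limits and word size become obligations, since their violation
  leaves no run at all. Loops are rejected; the single loop of the algorithm is treated directly in
  \<open>exec_scan\<close>.\<close>

primrec wp :: "limits \<Rightarrow> input \<Rightarrow> com \<Rightarrow> (state \<Rightarrow> bool) \<Rightarrow> state \<Rightarrow> bool" where
  "wp L i Skip Q s \<longleftrightarrow> Q s"
| "wp L i (Store a b) Q s \<longleftrightarrow> aval i s a < mem_size L \<and> aval i s b < 2 ^ word_bits L \<and>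
     Q (s\<lparr>mem := (mem s)(aval i s a := aval i s b)\<rparr>)"
| "wp L i (WStore a x) Q s \<longleftrightarrow> aval i s a < wmem_size L \<and>
     Q (s\<lparr>wmem := (wmem s)(aval i s a := wsval i s x)\<rparr>)"
| "wp L i (Emit a b) Q s \<longleftrightarrow> Q (s\<lparr>out_tape := out_tape s @ [(aval i s a, aval i s b)]\<rparr>)"
| "wp L i (Seq c d) Q s \<longleftrightarrow> wp L i c (wp L i d Q) s"
| "wp L i (If b c d) Q s \<longleftrightarrow> (if bval i s b then wp L i c Q s else wp L i d Q s)"
| "wp L i (While b c) Q s \<longleftrightarrow> False"

lemma wp_exec: "wp L i c Q s \<Longrightarrow> \<exists>t s'. exec L i c s t s' \<and> Q s' \<and> t \<le> max_time c"
proof (induction c arbitrary: Q s)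
  case Skip
  then show ?case using exec.Skip by fastforce
next
  case (Store a b)
  then show ?case using exec.Store by fastforce
next
  case (WStore a x)
  then show ?case using exec.WStore by fastforce
next
  case (Emit a b)
  then show ?case using exec.Emit by fastforce
next
  case (Seq c d)
  then obtain t s' where 1: "exec L i c s t s'" "wp L i d Q s'" "t \<le> max_time c"
    by (metis wp.simps(5))
  then obtain t' s'' where "exec L i d s' t' s''" "Q s''" "t' \<le> max_time d"
    using Seq.IH(2) by blast
  then show ?case using 1 exec.Seq by (fastforce intro: add_mono)
next
  case (If b c d)
  show ?case
  proof (cases "bval i s b")
    case True
    then obtain t s' where "exec L i c s t s'" "Q s'" "t \<le> max_time c"
      using If.prems If.IH(1)[of Q s] by auto
    then show ?thesis using exec.IfTrue[OF True] by (fastforce simp: le_max_iff_disj)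
  next
    case False
    then obtain t s' where "exec L i d s t s'" "Q s'" "t \<le> max_time d"
      using If.prems If.IH(2)[of Q s] by auto
    then show ?thesis using exec.IfFalse[OF False] by (fastforce simp: le_max_iff_disj)
  qed
qed simp

lemma process_deterministic:
  "process A n w s xs ts s1 \<Longrightarrow> process A n w s xs ts' s2 \<Longrightarrow> ts' = ts \<and> s2 = s1"
proof (induction arbitrary: ts' s2 rule: process.induct)
  case (Nil s)
  then show ?case by (cases rule: process.cases) auto
next
  case (Cons u v s t s' xs ts s'')
  from Cons.prems show ?case
  proof (cases rule: process.cases)
    case (Cons t1 s1 ts1)
    then show ?thesis using Cons.hyps(1) Cons.IH exec_deterministic by metis
  qed
qed

text \<open>Turns the existence of one fast run into a bound on every run, as
  \<open>linear_final_time\<close> demands.\<close>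

lemma run_deterministic:
  assumes "run A n w xs ts t M" "run A n w xs ts' t' M'"
  shows "ts' = ts \<and> t' = t \<and> M' = M"
proof -
  obtain s s1 where 1: "process A n w initial_state xs ts s"
    "exec (resources A n) \<lparr>num_vertices = n, in_u = 0, in_v = 0, in_w = 0\<rparr> (final_prog A) s t s1"
    "M = edge_of ` set (out_tape s1)" using assms(1) unfolding run_def by blast
  obtain s' s2 where 2: "process A n w initial_state xs ts' s'"
    "exec (resources A n) \<lparr>num_vertices = n, in_u = 0, in_v = 0, in_w = 0\<rparr> (final_prog A) s' t' s2"
    "M' = edge_of ` set (out_tape s2)" using assms(2) unfolding run_def by blast
  have "ts' = ts \<and> s' = s" using process_deterministic[OF 1(1) 2(1)] .
  then show ?thesis using exec_deterministic[OF 1(2)] 2 1(3) by metis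
qed

section \<open>Memory layout and circular doubly linked lists\<close>

text \<open>
  The word memory consists of records of eight cells. Record \<open>a\<close> holds the successor (0) and the
  predecessor (1) of node \<open>a\<close> in a circular doubly linked list with sentinel 0 and, if \<open>a\<close> is in use,
  the successor of the number of the neighbour (2); as a vertex, \<open>a\<close> has the number of its pushes
  modulo 4 (3), its potential in sixteenths of the weight in weight cell \<open>a\<close> (4) and a mark (5).
  Cells 6 and 7 of record 0 are temporary.
\<close>

definition addr :: "nat \<Rightarrow> nat \<Rightarrow> nat" where
  "addr f a = 8 * a + f"

lemma addr_eq [simp]: "f < 8 \<Longrightarrow> g < 8 \<Longrightarrow> addr f a = addr g b \<longleftrightarrow> f = g \<and> a = b"
  unfolding addr_def by presburger

definition cell :: "nat \<Rightarrow> aexp \<Rightarrow> aexp" where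
  "cell f a = Plus (Times (Const 8) a) (Const f)"

lemma aval_cell [simp]: "aval i s (cell f a) = addr f (aval i s a)"
  by (simp add: cell_def addr_def)

abbreviation get :: "nat \<Rightarrow> aexp \<Rightarrow> aexp" where
  "get f a \<equiv> Mem (cell f a)"

abbreviation put :: "nat \<Rightarrow> aexp \<Rightarrow> aexp \<Rightarrow> com" where
  "put f a \<equiv> Store (cell f a)"

abbreviation cur :: aexp where
  "cur \<equiv> get 6 (Const 0)"

text \<open>There are \<open>4 * n + 1\<close> records of eight cells: four slots per vertex and the
  sentinel. Stored words are record numbers, vertex numbers and small constants, never cell
  addresses, so values up to \<open>4 * n + 16\<close> suffice.\<close>

definition ram :: "nat \<Rightarrow> limits" where
  "ram n = \<lparr>mem_size = 32 * n + 8, wmem_size = n, word_bits = floorlog 2 n + 5\<rparr>"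

lemma wmem_size_ram [simp]: "wmem_size (ram n) = n"
  by (simp add: ram_def)

lemma addr_ram [simp]: "f < 8 \<Longrightarrow> a \<le> 4 * n \<Longrightarrow> addr f a < mem_size (ram n)"
  by (simp add: ram_def addr_def)

lemma word_ram:
  assumes "k \<le> 4 * n + 16"
  shows "k < 2 ^ word_bits (ram n)"
proof -
  have "n < 2 ^ floorlog 2 n"
    using floorlog_bounds[of n 2] by (cases "n = 0") (auto simp: floorlog_def)
  then show ?thesis using assms by (simp add: ram_def power_add)
qed

text \<open>Segments with free ends can be split and joined at any node; the circle with its
  sentinel is the case \<open>a = b = 0\<close>.\<close>

fun dll :: "(nat \<Rightarrow> nat) \<Rightarrow> nat \<Rightarrow> nat list \<Rightarrow> nat \<Rightarrow> bool" where
  "dll m a [] b \<longleftrightarrow> m (addr 0 a) = b \<and> m (addr 1 b) = a"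
| "dll m a (x # xs) b \<longleftrightarrow> m (addr 0 a) = x \<and> m (addr 1 x) = a \<and> dll m x xs b"

lemma dll_next: "dll m a xs b \<Longrightarrow> m (addr 0 a) = hd (xs @ [b])"
  by (cases xs) auto

lemma dll_append: "dll m a (ys @ x # zs) b \<longleftrightarrow> dll m a ys x \<and> dll m x zs b"
  by (induction ys arbitrary: a) auto

lemma dll_prev: "dll m a xs b \<Longrightarrow> m (addr 1 b) \<in> set (a # xs)"
  by (induction xs arbitrary: a) auto

lemma dll_cong:
  assumes "dll m a xs b" "\<And>c. c \<in> set (a # xs) \<Longrightarrow> m' (addr 0 c) = m (addr 0 c)"
    "\<And>c. c \<in> set (b # xs) \<Longrightarrow> m' (addr 1 c) = m (addr 1 c)"
  shows "dll m' a xs b"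
  using assms by (induction xs arbitrary: a) auto

text \<open>Induction on \<open>ys\<close>: while it is nonempty, \<open>p\<close> lies in
  \<open>ys\<close> and \<open>q\<close> comes after \<open>x\<close>, so the first link of the
  segment is untouched. Both writes matter only once \<open>ys\<close> is empty.\<close>

lemma dll_unlink:
  assumes "dll m a ys x" "dll m x zs b" "distinct (a # ys @ x # zs)" "b \<notin> set (ys @ x # zs)"
    "p = m (addr 1 x)" "q = m (addr 0 x)"
  shows "dll (m(addr 0 p := q, addr 1 q := p)) a (ys @ zs) b"
  using assms(1,3-)
proof (induction ys arbitrary: a)
  case Nil
  show ?case
  proof (cases zs)
    case Nil
    then show ?thesis using Nil.prems assms(2) by auto
  next
    case (Cons z zs')
    then have q: "q = z" "p = a" "dll m z zs' b" "m (addr 1 z) = x" using Nil.prems assms(2) by auto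
    have "dll (m(addr 0 p := q, addr 1 q := p)) z zs' b"
      using q Cons Nil.prems by (intro dll_cong[OF q(3)]) auto
    then show ?thesis using q Cons by (simp add: fun_upd_same fun_upd_other del: fun_upd_apply)
  qed
next
  case (Cons y ys)
  have "p \<in> set (y # ys)" using Cons.prems(1,4) dll_prev[of m y ys x] by auto
  moreover have "q \<in> set (zs @ [b])"
    using assms(2) Cons.prems(5) dll_next by (metis hd_in_set snoc_eq_iff_butlast)
  ultimately have "p \<noteq> a" "q \<noteq> y" using Cons.prems(2,3) by auto
  then show ?case using Cons.IH[of y] Cons.prems by auto
qed

lemma dll_insert:
  assumes "dll m a xs b" "distinct (x # a # xs)" "b \<notin> set (x # xs)"
  shows "dll (m(addr 0 x := m (addr 0 a), addr 1 x := a, addr 1 (m (addr 0 a)) := x, addr 0 a := x))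
    a (x # xs) b"
proof (cases xs)
  case Nil
  then show ?thesis using assms by auto
next
  case (Cons y ys)
  then have y: "m (addr 0 a) = y" "m (addr 1 y) = a" "dll m y ys b" using assms by auto
  have "dll (m(addr 0 x := m (addr 0 a), addr 1 x := a, addr 1 (m (addr 0 a)) := x, addr 0 a := x)) y ys b"
    using assms Cons y by (intro dll_cong[OF y(3)]) auto
  then show ?thesis using y Cons assms by auto
qed

text \<open>The 0 in cell 2 of every node outside the list is what lets \<open>unlink\<close>
  recognise a slot that is not yet filled.\<close>

definition linked :: "(nat \<Rightarrow> nat) \<Rightarrow> (nat \<times> nat) list \<Rightarrow> bool" where
  "linked m hs \<longleftrightarrow> dll m 0 (map fst (buffer 4 hs)) 0 \<and>
     (\<forall>h \<in> set (buffer 4 hs). m (addr 2 (fst h)) = Suc (snd h)) \<and>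
     (\<forall>a. a \<notin> fst ` set (buffer 4 hs) \<longrightarrow> m (addr 2 a) = 0) \<and>
     (\<forall>x. m (addr 3 x) = pushes hs x mod 4)"

section \<open>Pushing a half-edge into its ring buffer\<close>

definition unlink :: com where
  "unlink = If (Less (Const 0) (get 2 cur))
     (Seq (put 0 (get 1 cur) (get 0 cur)) (put 1 (get 0 cur) (get 1 cur))) Skip"

definition insert_front :: com where
  "insert_front = Seq (put 0 cur (get 0 (Const 0))) (Seq (put 1 cur (Const 0))
     (Seq (put 1 (get 0 (Const 0)) cur) (put 0 (Const 0) cur)))"

text \<open>Cell 3 counts modulo 4 only, as the residue determines the slot. If the slot is in use,
  it holds the oldest of the four kept pushes; it is taken out of the list and reused at the
  front.\<close>

definition push_half :: "aexp \<Rightarrow> aexp \<Rightarrow> com" where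
  "push_half X Y = Seq (put 6 (Const 0) (Plus (Const 1) (Plus (Times (Const 4) X) (get 3 X))))
     (Seq unlink (Seq (put 2 cur (Plus Y (Const 1))) (Seq insert_front
     (put 3 X (Mod (Plus (get 3 X) (Const 1)) (Const 4))))))"

lemma buffer_bounds:
  assumes "\<forall>h \<in> set hs. fst h < n" "h \<in> set (buffer 4 hs)"
  shows "0 < fst h \<and> fst h \<le> 4 * n \<and> (fst h - 1) div 4 < n"
proof -
  obtain x i where "(x, snd h) \<in> set hs" and h: "fst h = node 4 x i" using buffer_set[OF assms(2)] by blast
  then have "x < n" using assms(1) by force
  moreover have "i mod 4 < 4" by simp
  ultimately show ?thesis unfolding h by (auto simp: node_def)
qed

text \<open>Of the new memory, \<open>Q\<close> may use the shortened list and the unchanged cells 2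
  to 7; this form chains through \<open>Seq\<close>. If \<open>x\<close> is not in the list, the
  filter changes nothing.\<close>

lemma wp_unlink:
  assumes dll: "dll (mem s) 0 xs 0" and dist: "distinct (0 # xs)"
    and bound: "\<And>a. a \<in> set xs \<Longrightarrow> a \<le> 4 * n"
    and used: "\<And>a. 0 < mem s (addr 2 a) \<longleftrightarrow> a \<in> set xs"
    and cur: "mem s (addr 6 0) = x"
    and Q: "\<And>m. dll m 0 (filter (\<lambda>a. a \<noteq> x) xs) 0 \<Longrightarrow>
      (\<And>f a. 2 \<le> f \<Longrightarrow> f < 8 \<Longrightarrow> m (addr f a) = mem s (addr f a)) \<Longrightarrow> Q (s\<lparr>mem := m\<rparr>)"
  shows "wp (ram n) i unlink Q s"
proof (cases "x \<in> set xs")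
  case False
  then have "filter (\<lambda>a. a \<noteq> x) xs = xs" by (auto simp: filter_id_conv)
  then have "Q (s\<lparr>mem := mem s\<rparr>)" using dll by (intro Q) auto
  then show ?thesis using False used[of x] cur by (simp add: unlink_def)
next
  case True
  then obtain ys zs where xs: "xs = ys @ x # zs" by (meson split_list)
  define p where "p = mem s (addr 1 x)"
  define q where "q = mem s (addr 0 x)"
  have d: "dll (mem s) 0 ys x" "dll (mem s) x zs 0" using dll xs dll_append by auto
  have p: "p \<in> set (0 # ys)" using dll_prev[OF d(1)] by (simp add: p_def)
  have q: "q \<in> set (zs @ [0])" using dll_next[OF d(2)]
    by (metis q_def hd_in_set snoc_eq_iff_butlast)
  have b: "p \<le> 4 * n" "q \<le> 4 * n" "p \<noteq> x" using p q bound xs dist by auto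
  have "filter (\<lambda>a. a \<noteq> x) xs = ys @ zs" using dist xs by (auto simp: filter_id_conv intro!: arg_cong2[where f = append])
  moreover have "dll ((mem s)(addr 0 p := q, addr 1 q := p)) 0 (ys @ zs) 0"
    using dist xs by (intro dll_unlink[OF d]) (auto simp: p_def q_def)
  ultimately have "Q (s\<lparr>mem := (mem s)(addr 0 p := q, addr 1 q := p)\<rparr>)"
    by (intro Q) auto
  moreover have "mem s (addr (Suc 0) x) = p" "mem s (addr 0 x) = q" by (simp_all add: p_def q_def)
  ultimately show ?thesis
    using True used[of x] cur b word_ram[of p n] word_ram[of q n] by (simp add: unlink_def)
qed

lemma wp_insert_front:
  assumes dll: "dll (mem s) 0 xs 0" and dist: "distinct (0 # xs)"
    and bound: "\<And>a. a \<in> set xs \<Longrightarrow> a \<le> 4 * n" "x \<le> 4 * n"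
    and x: "x \<notin> set xs" "0 < x"
    and cur: "mem s (addr 6 0) = x"
    and Q: "\<And>m. dll m 0 (x # xs) 0 \<Longrightarrow>
      (\<And>f a. 2 \<le> f \<Longrightarrow> f < 8 \<Longrightarrow> m (addr f a) = mem s (addr f a)) \<Longrightarrow> Q (s\<lparr>mem := m\<rparr>)"
  shows "wp (ram n) i insert_front Q s"
proof -
  define q where "q = mem s (addr 0 0)"
  have "q \<in> set (xs @ [0])" using dll_next[OF dll] by (metis q_def hd_in_set snoc_eq_iff_butlast)
  then have q: "q \<le> 4 * n" "q \<noteq> x" using bound x by auto
  have "dll ((mem s)(addr 0 x := q, addr 1 x := 0, addr 1 q := x, addr 0 0 := x)) 0 (x # xs) 0"
    using dll_insert[OF dll, of x] dist x by (simp flip: q_def)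
  then have "Q (s\<lparr>mem := (mem s)(addr 0 x := q, addr 1 x := 0, addr 1 q := x, addr 0 0 := x)\<rparr>)"
    by (rule Q) auto
  then show ?thesis using q x bound cur word_ram[of q n] word_ram[of x n]
    by (simp add: insert_front_def flip: q_def)
qed

lemma wp_push_half:
  assumes linked: "linked (mem s) hs" and hs: "\<forall>h \<in> set hs. fst h < n"
    and xy: "x < n" "y < n" "\<And>s. aval i s X = x" "\<And>s. aval i s Y = y"
    and Q: "\<And>m. linked m ((x, y) # hs) \<Longrightarrow>
      (\<And>f a. 4 \<le> f \<Longrightarrow> f < 8 \<Longrightarrow> f \<noteq> 6 \<Longrightarrow> m (addr f a) = mem s (addr f a)) \<Longrightarrow> Q (s\<lparr>mem := m\<rparr>)"
  shows "wp (ram n) i (push_half X Y) Q s"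
proof -
  define l where "l = buffer 4 hs"
  define z where "z = node 4 x (pushes hs x)"
  define l' where "l' = filter (\<lambda>h. fst h \<noteq> z) l"
  have L: "dll (mem s) 0 (map fst l) 0" "\<And>h. h \<in> set l \<Longrightarrow> mem s (addr 2 (fst h)) = Suc (snd h)"
    "\<And>a. a \<notin> fst ` set l \<Longrightarrow> mem s (addr 2 a) = 0" "\<And>x. mem s (addr 3 x) = pushes hs x mod 4"
    using linked by (auto simp: linked_def l_def)
  have bounds: "0 < a \<and> a \<le> 4 * n" if "a \<in> set (map fst l)" for a
    using that buffer_bounds[OF hs] by (auto simp: l_def)
  have dist: "distinct (0 # map fst l)"
    using bounds distinct_buffer[of 4 hs] by (force simp: l_def)
  \<comment> \<open>The equation identifies the slot with the number that \<open>push_half\<close>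
    computes from the residue.\<close>
  have z: "0 < z" "z \<le> 4 * n" "1 + (4 * x + pushes hs x mod 4) = z"
  proof -
    have "pushes hs x mod 4 < 4" by simp
    then show "0 < z" "z \<le> 4 * n" "1 + (4 * x + pushes hs x mod 4) = z"
      using xy(1) by (auto simp: z_def node_def)
  qed
  have map_l': "filter (\<lambda>a. a \<noteq> z) (map fst l) = map fst l'"
    by (simp add: l'_def filter_map comp_def)
  have dist': "distinct (0 # map fst l')" "z \<notin> set (map fst l')"
    using dist by (auto simp: l'_def distinct_map_filter)
  have buf: "buffer 4 ((x, y) # hs) = (z, y) # l'" by (simp add: l'_def l_def z_def)
  define s1 where "s1 = s\<lparr>mem := (mem s)(addr 6 0 := z)\<rparr>"
  have "wp (ram n) i unlink (wp (ram n) i (Seq (put 2 cur (Plus Y (Const 1))) (Seq insert_front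
     (put 3 X (Mod (Plus (get 3 X) (Const 1)) (Const 4))))) Q) s1"
  proof (rule wp_unlink)
    show "dll (mem s1) 0 (map fst l) 0" by (rule dll_cong[OF L(1)]) (auto simp: s1_def)
    show "distinct (0 # map fst l)" by fact
    show "a \<le> 4 * n" if "a \<in> set (map fst l)" for a using bounds[OF that] by simp
    show "0 < mem s1 (addr 2 a) \<longleftrightarrow> a \<in> set (map fst l)" for a
    proof (cases "a \<in> fst ` set l")
      case True
      then show ?thesis using L(2) by (auto simp: s1_def)
    next
      case False
      then show ?thesis using L(3)[OF False] by (simp add: s1_def)
    qed
    show "mem s1 (addr 6 0) = z" by (simp add: s1_def)
  next
    fix m assume m: "dll m 0 (filter (\<lambda>a. a \<noteq> z) (map fst l)) 0"
      "\<And>f a. 2 \<le> f \<Longrightarrow> f < 8 \<Longrightarrow> m (addr f a) = mem s1 (addr f a)"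
    define s2 where "s2 = s\<lparr>mem := m(addr 2 z := Suc y)\<rparr>"
    have m2: "mem s2 (addr f a) = (if f = 2 \<and> a = z then Suc y else
      if f = 6 \<and> a = 0 then z else mem s (addr f a))" if "2 \<le> f" "f < 8" for f a
      using m(2)[OF that] that by (auto simp: s2_def s1_def)
    have "wp (ram n) i insert_front (wp (ram n) i (put 3 X (Mod (Plus (get 3 X) (Const 1)) (Const 4))) Q) s2"
    proof (rule wp_insert_front)
      show "dll (mem s2) 0 (map fst l') 0"
        using m(1) unfolding map_l' by (rule dll_cong) (auto simp: s2_def)
      show "distinct (0 # map fst l')" "z \<notin> set (map fst l')" by fact+
      show "a \<le> 4 * n" if "a \<in> set (map fst l')" for a using bounds[of a] that by (auto simp: l'_def)
      show "z \<le> 4 * n" "0 < z" by fact+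
      show "mem s2 (addr 6 0) = z" by (simp add: m2)
    next
      fix m' assume m': "dll m' 0 (z # map fst l') 0"
        "\<And>f a. 2 \<le> f \<Longrightarrow> f < 8 \<Longrightarrow> m' (addr f a) = mem s2 (addr f a)"
      define m3 where "m3 = m'(addr 3 x := Suc (pushes hs x) mod 4)"
      have m3: "m3 (addr f a) = (if f = 3 \<and> a = x then Suc (pushes hs x) mod 4 else
        if f = 2 \<and> a = z then Suc y else if f = 6 \<and> a = 0 then z else mem s (addr f a))"
        if "2 \<le> f" "f < 8" for f a
        using m'(2)[OF that] m2[OF that] that by (auto simp: m3_def)
      have 1: "dll m3 0 (z # map fst l') 0" using m'(1) by (rule dll_cong) (auto simp: m3_def)
      have 2: "m3 (addr 2 a) = 0" if "a \<notin> fst ` set ((z, y) # l')" for a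
      proof -
        have "a \<noteq> z" using that by simp
        moreover from this that have "a \<notin> fst ` set l" by (auto simp: l'_def)
        ultimately show ?thesis using L(3) by (simp add: m3)
      qed
      have 3: "m3 (addr 2 (fst h)) = Suc (snd h)" if "h \<in> set ((z, y) # l')" for h
      proof (cases "h = (z, y)")
        case False
        then have "h \<in> set l" "fst h \<noteq> z" using that by (simp_all add: l'_def)
        then show ?thesis using L(2)[of h] by (simp add: m3)
      qed (simp add: m3)
      have 4: "m3 (addr 3 a) = pushes ((x, y) # hs) a mod 4" for a
        using L(4) by (simp add: m3)
      have "linked m3 ((x, y) # hs)"
        unfolding linked_def buf list.map fst_conv by (intro conjI ballI allI impI 1 2 3 4)
      then have "Q (s\<lparr>mem := m3\<rparr>)" by (rule Q) (simp add: m3)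
      moreover have "m' (addr 3 x) = pushes hs x mod 4" by (simp add: m' m2 L(4))
      moreover have "Suc (pushes hs x) mod 4 \<le> 4 * n + 16"
        using mod_less_divisor[of 4 "Suc (pushes hs x)"] by linarith
      ultimately show "wp (ram n) i (put 3 X (Mod (Plus (get 3 X) (Const 1)) (Const 4))) Q (s2\<lparr>mem := m'\<rparr>)"
        using xy by (simp add: m3_def s2_def word_ram mod_Suc_eq)
    qed
    moreover have "m (addr 6 0) = z" using m(2) by (simp add: s1_def)
    ultimately show "wp (ram n) i (Seq (put 2 cur (Plus Y (Const 1))) (Seq insert_front
      (put 3 X (Mod (Plus (get 3 X) (Const 1)) (Const 4))))) Q (s1\<lparr>mem := m\<rparr>)"
      using xy z word_ram[of "Suc y" n] by (simp add: s1_def s2_def)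
  qed
  then show ?thesis
    using xy z word_ram[of z n] by (simp add: push_half_def s1_def L(4))
qed

section \<open>Processing one edge of the stream\<close>

definition scaled :: "aexp \<Rightarrow> wexp" where
  "scaled X = WTimes (WOfNat (get 4 X)) (WVal (WMem X))"

definition residual :: "aexp \<Rightarrow> wexp" where
  "residual X = WMinus (WTimes (WConst 16) (WVal InW)) (scaled X)"

text \<open>The machine cannot divide weights, so the multiplier is found by trial. Nested
  conditionals instead of a loop keep the program loop-free and its time constant.\<close>

fun round_up :: "aexp \<Rightarrow> wexp \<Rightarrow> nat \<Rightarrow> nat \<Rightarrow> com" where
  "round_up a r j 0 = Store a (Const j)"
| "round_up a r j (Suc k) = If (WLess (WTimes (WOfNat (Const j)) (WVal InW)) r)
     (round_up a r (Suc j) k) (Store a (Const j))"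

lemma loop_free_round_up [simp]: "loop_free (round_up a r j k)"
  by (induction a r j k rule: round_up.induct) auto

text \<open>The hypotheses say that candidate \<open>j\<close> overshoots by at most one step and
  that \<open>j + k\<close> suffices. A failed candidate is too small, which preserves the first;
  the second makes the last candidate safe without a test.\<close>

lemma wp_round_up:
  assumes "j + k \<le> 16" "aval i s a < mem_size (ram n)"
    "real j * in_w i \<le> wval i s r + in_w i" "wval i s r \<le> real (j + k) * in_w i"
    and Q: "\<And>l. wval i s r \<le> real l * in_w i \<Longrightarrow> real l * in_w i \<le> wval i s r + in_w i \<Longrightarrow> l \<le> 16 \<Longrightarrow>
      Q (s\<lparr>mem := (mem s)(aval i s a := l)\<rparr>)"
  shows "wp (ram n) i (round_up a r j k) Q s"
  using assms(1,3,4)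
proof (induction k arbitrary: j)
  case 0
  then show ?case using assms(2) Q word_ram[of j n] by simp
next
  case (Suc k)
  show ?case
  proof (cases "real j * in_w i < wval i s r")
    case True
    then show ?thesis using Suc.IH[of "Suc j"] Suc.prems by (simp add: algebra_simps)
  next
    case False
    then show ?thesis using Suc.prems assms(2) Q word_ram[of j n] by simp
  qed
qed

text \<open>The new value for \<open>u\<close> waits in a temporary cell, because the old potential
  of \<open>u\<close> is still needed for \<open>v\<close>. The weight cells change only after both
  roundings.\<close>

definition step_prog :: com where
  "step_prog = If (WLess (WTimes (WConst 2) (WPlus (scaled InU) (scaled InV)))
       (WTimes (WConst 16) (WVal InW)))
     (Seq (round_up (cell 7 (Const 0)) (residual InV) 0 16)
     (Seq (round_up (cell 4 InV) (residual InU) 0 16)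
     (Seq (put 4 InU (get 7 (Const 0)))
     (Seq (WStore InU InW) (Seq (WStore InV InW)
     (Seq (push_half InU InV) (push_half InV InU))))))) Skip"

definition potential :: "state \<Rightarrow> nat \<Rightarrow> real" where
  "potential s x = real (mem s (addr 4 x)) * wmem s x / 16"

definition invariant :: "nat \<Rightarrow> (nat set \<Rightarrow> real) \<Rightarrow> (nat \<times> nat) set \<Rightarrow> (nat \<times> nat) list \<Rightarrow> state \<Rightarrow> bool" where
  "invariant n w S es s \<longleftrightarrow> history w n (1/16) (potential s) es \<and> set es \<subseteq> S \<and>
     (\<forall>(u, v) \<in> S. w {u, v} \<le> 2 * (potential s u + potential s v)) \<and>
     linked (mem s) (halves es) \<and> (\<forall>x. mem s (addr 5 x) = 0) \<and> out_tape s = []"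

lemma history_vertices: "history w n \<eta> p es \<Longrightarrow> \<forall>h \<in> set (halves es). fst h < n \<and> snd h < n"
  by (induction rule: history.induct) auto

lemma wp_step_prog:
  fixes w :: "nat set \<Rightarrow> real"
  assumes inv: "invariant n w S es s" and uv: "u < n" "v < n" "u \<noteq> v" and nonneg: "0 \<le> w {u, v}"
  shows "wp (ram n) \<lparr>num_vertices = n, in_u = u, in_v = v, in_w = w {u, v}\<rparr> step_prog
    (\<lambda>s'. \<exists>es'. invariant n w (insert (u, v) S) es' s') s"
proof -
  define i where "i = \<lparr>num_vertices = n, in_u = u, in_v = v, in_w = w {u, v}\<rparr>"
  define W where "W = w {u, v}"
  define p where "p = potential s"
  define Q where "Q = (\<lambda>s'. \<exists>es'. invariant n w (insert (u, v) S) es' s')"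
  have i [simp]: "in_u i = u" "in_v i = v" "in_w i = W" by (simp_all add: i_def W_def)
  have I: "history w n (1/16) p es" "set es \<subseteq> S"
    "\<And>x y. (x, y) \<in> S \<Longrightarrow> w {x, y} \<le> 2 * (p x + p y)"
    "linked (mem s) (halves es)" "\<And>x. mem s (addr 5 x) = 0" "out_tape s = []"
    using inv by (auto simp: invariant_def p_def)
  have p: "0 \<le> p x" for x using history_nonneg[OF I(1)] .
  have scaled: "real (mem s (addr 4 x)) * wmem s x = 16 * p x" for x by (simp add: p_def potential_def)
  have W0: "0 \<le> W" using nonneg by (simp add: W_def)
  show ?thesis unfolding i_def[symmetric] Q_def[symmetric]
  proof (cases "2 * (p u + p v) < W")
    case False
    then have "invariant n w (insert (u, v) S) es s"
      using inv by (auto simp: invariant_def p_def W_def)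
    moreover have "\<not> 2 * (16 * p u + 16 * p v) < 16 * W" using False by simp
    ultimately show "wp (ram n) i step_prog Q s"
      by (auto simp: step_prog_def scaled_def scaled Q_def)
  next
    case True
    \<comment> \<open>These facts about the final memory suffice for the invariant. Rounding
      \<open>16 * W - 16 * p v\<close> up to a multiple of \<open>W\<close> is rounding with
      \<open>\<eta> = 1/16\<close> after division by 16.\<close>
    have final: "Q (s\<lparr>mem := m2, wmem := (wmem s)(u := W, v := W)\<rparr>)"
      if a: "16 * W - 16 * p v \<le> real a * W" "real a * W \<le> 16 * W - 16 * p v + W"
        and b: "16 * W - 16 * p u \<le> real b * W" "real b * W \<le> 16 * W - 16 * p u + W"
        and m2: "linked m2 (halves ((u, v) # es))" "\<And>x. m2 (addr 5 x) = 0"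
          "\<And>x. m2 (addr 4 x) = (if x = u then a else if x = v then b else mem s (addr 4 x))"
      for a b m2
    proof -
      define s' where "s' = s\<lparr>mem := m2, wmem := (wmem s)(u := W, v := W)\<rparr>"
      have pot: "potential s' = p(u := real a * W / 16, v := real b * W / 16)"
        using uv(3) by (auto simp: potential_def s'_def m2(3) p_def fun_eq_iff)
      have pot_uv: "potential s' u = real a * W / 16" "potential s' v = real b * W / 16"
        using uv(3) by (simp_all add: pot)
      have True': "2 * p u + 2 * p v < W" using True by simp
      have 1: "history w n (1/16) (potential s') ((u, v) # es)"
        unfolding pot
      proof (rule history.Push[OF I(1) uv])
        show "2 * (p u + p v) < w {u, v}" using True by (simp add: W_def)
      qed (use a b in \<open>unfold W_def[symmetric], linarith+\<close>)
      \<comment> \<open>Potentials never fall, so edges seen earlier stay covered.\<close>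
      have mono: "p x \<le> potential s' x" for x
      proof -
        have "p u \<le> potential s' u" "p v \<le> potential s' v"
          unfolding pot_uv using a(1) b(1) True' p[of u] p[of v] by linarith+
        moreover have "potential s' x = p x" if "x \<noteq> u" "x \<noteq> v" using that by (simp add: pot)
        ultimately show ?thesis by (cases "x = u"; cases "x = v") auto
      qed
      have 2: "w {x, y} \<le> 2 * (potential s' x + potential s' y)" if "(x, y) \<in> S" for x y
        using I(3)[OF that] mono[of x] mono[of y] by simp
      \<comment> \<open>The pushed edge is covered too: the new potentials add up to at least
        \<open>2 * W - p u - p v\<close>, which exceeds \<open>W\<close>.\<close>
      have "W \<le> 2 * potential s' u + 2 * potential s' v"
        unfolding pot_uv using a(1) b(1) True' p[of u] p[of v] by linarith
      then have 3: "w {u, v} \<le> 2 * (potential s' u + potential s' v)" by (simp add: W_def)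
      have "invariant n w (insert (u, v) S) ((u, v) # es) s'"
        unfolding invariant_def
      proof (intro conjI 1)
        show "\<forall>(x, y) \<in> insert (u, v) S. w {x, y} \<le> 2 * (potential s' x + potential s' y)"
          using 2 3 by auto
        show "set ((u, v) # es) \<subseteq> insert (u, v) S" using I(2) by auto
      qed (use m2(1,2) I(6) in \<open>simp_all add: s'_def\<close>)
      then show ?thesis by (auto simp: Q_def s'_def)
    qed
    define c where "c = Seq (push_half InU InV) (push_half InV InU)"
    have push: "wp (ram n) i c Q (s\<lparr>mem := m, wmem := (wmem s)(u := W, v := W)\<rparr>)"
      if a: "16 * W - 16 * p v \<le> real a * W" "real a * W \<le> 16 * W - 16 * p v + W"
        and b: "16 * W - 16 * p u \<le> real b * W" "real b * W \<le> 16 * W - 16 * p u + W"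
        and m: "m = (mem s)(addr 7 0 := a, addr 4 v := b, addr 4 u := a)" for a b m
    proof -
      have hs: "\<forall>h \<in> set (halves es). fst h < n" using history_vertices[OF I(1)] by simp
      have linked: "linked m (halves es)"
      proof -
        have "dll m 0 (map fst (buffer 4 (halves es))) 0"
          by (rule dll_cong[of "mem s"]) (use I(4) in \<open>auto simp: linked_def m\<close>)
        then show ?thesis using I(4) by (auto simp: linked_def m)
      qed
      show ?thesis unfolding c_def wp.simps(5)
      proof (rule wp_push_half)
        show "linked (mem (s\<lparr>mem := m, wmem := (wmem s)(u := W, v := W)\<rparr>)) (halves es)"
          using linked by simp
      next
        fix m1 assume m1: "linked m1 ((u, v) # halves es)" "\<And>f a. 4 \<le> f \<Longrightarrow> f < 8 \<Longrightarrow> f \<noteq> 6 \<Longrightarrow>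
          m1 (addr f a) = mem (s\<lparr>mem := m, wmem := (wmem s)(u := W, v := W)\<rparr>) (addr f a)"
        show "wp (ram n) i (push_half InV InU) Q
          (s\<lparr>mem := m, wmem := (wmem s)(u := W, v := W)\<rparr>\<lparr>mem := m1\<rparr>)"
        proof (rule wp_push_half)
          show "linked (mem (s\<lparr>mem := m, wmem := (wmem s)(u := W, v := W)\<rparr>\<lparr>mem := m1\<rparr>))
            ((u, v) # halves es)" using m1(1) by simp
        next
          fix m2 assume m2: "linked m2 ((v, u) # (u, v) # halves es)"
            "\<And>f a. 4 \<le> f \<Longrightarrow> f < 8 \<Longrightarrow> f \<noteq> 6 \<Longrightarrow> m2 (addr f a) =
              mem (s\<lparr>mem := m, wmem := (wmem s)(u := W, v := W)\<rparr>\<lparr>mem := m1\<rparr>) (addr f a)"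
          have "Q (s\<lparr>mem := m2, wmem := (wmem s)(u := W, v := W)\<rparr>)"
            using m2 m1 I(5) uv(3) by (intro final[OF a b]) (auto simp: m)
          then show "Q (s\<lparr>mem := m, wmem := (wmem s)(u := W, v := W)\<rparr>\<lparr>mem := m1\<rparr>\<lparr>mem := m2\<rparr>)"
            by (cases s) simp
        qed (use uv hs in auto)
      qed (use uv hs in auto)
    qed
    have word: "(a :: nat) \<le> 16 \<Longrightarrow> a < 2 ^ word_bits (ram n)" for a by (rule word_ram) simp
    have "wp (ram n) i (round_up (cell 7 (Const 0)) (residual InV) 0 16)
      (wp (ram n) i (Seq (round_up (cell 4 InV) (residual InU) 0 16)
        (Seq (put 4 InU (get 7 (Const 0))) (Seq (WStore InU InW) (Seq (WStore InV InW) c)))) Q) s"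
    proof (rule wp_round_up)
      fix a assume a: "wval i s (residual InV) \<le> real a * in_w i"
        "real a * in_w i \<le> wval i s (residual InV) + in_w i" "a \<le> 16"
      then have a': "16 * W - 16 * p v \<le> real a * W" "real a * W \<le> 16 * W - 16 * p v + W"
        by (simp_all add: residual_def scaled_def scaled)
      define s1 where "s1 = s\<lparr>mem := (mem s)(addr 7 0 := a)\<rparr>"
      have "wp (ram n) i (round_up (cell 4 InV) (residual InU) 0 16)
        (wp (ram n) i (Seq (put 4 InU (get 7 (Const 0))) (Seq (WStore InU InW) (Seq (WStore InV InW) c))) Q) s1"
      proof (rule wp_round_up)
        fix b assume b: "wval i s1 (residual InU) \<le> real b * in_w i"
          "real b * in_w i \<le> wval i s1 (residual InU) + in_w i" "b \<le> 16"
        then have b': "16 * W - 16 * p u \<le> real b * W" "real b * W \<le> 16 * W - 16 * p u + W"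
          by (simp_all add: residual_def scaled_def scaled s1_def)
        show "wp (ram n) i (Seq (put 4 InU (get 7 (Const 0))) (Seq (WStore InU InW) (Seq (WStore InV InW) c))) Q
          (s1\<lparr>mem := (mem s1)(aval i s1 (cell 4 InV) := b)\<rparr>)"
          using push[OF a' b' refl] uv a(3) by (simp add: s1_def word)
      qed (use uv W0 True p[of u] p[of v] in \<open>auto simp: residual_def scaled_def scaled s1_def\<close>)
      then show "wp (ram n) i (Seq (round_up (cell 4 InV) (residual InU) 0 16)
        (Seq (put 4 InU (get 7 (Const 0))) (Seq (WStore InU InW) (Seq (WStore InV InW) c)))) Q
        (s\<lparr>mem := (mem s)(aval i s (cell 7 (Const 0)) := a)\<rparr>)"
        by (simp add: s1_def)
    qed (use uv W0 True p[of u] p[of v] in \<open>auto simp: residual_def scaled_def scaled\<close>)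
    moreover have "2 * (16 * p u + 16 * p v) < 16 * W" using True by simp
    ultimately show "wp (ram n) i step_prog Q s"
      by (simp add: step_prog_def scaled_def scaled c_def)
  qed
qed

section \<open>The final scan and the algorithm\<close>

abbreviation owner :: aexp where
  "owner \<equiv> Div (Minus cur (Const 1)) (Const 4)"

abbreviation neighbour :: aexp where
  "neighbour \<equiv> Minus (get 2 cur) (Const 1)"

definition scan_body :: com where
  "scan_body = Seq
     (If (And (Not (Less (Const 0) (get 5 owner))) (Not (Less (Const 0) (get 5 neighbour))))
       (Seq (Emit owner neighbour) (Seq (put 5 owner (Const 1)) (put 5 neighbour (Const 1)))) Skip)
     (put 6 (Const 0) (get 0 cur))"

definition scan_prog :: com where
  "scan_prog = Seq (put 6 (Const 0) (get 0 (Const 0))) (While (Less (Const 0) cur) scan_body)"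

text \<open>The marked vertices are the blocked set of \<open>greedy\<close>. Each round costs a
  test and the body; the extra 1 is the failing test at the end.\<close>

lemma exec_scan:
  assumes "dll (mem s) a (map fst l) 0" "mem s (addr 6 0) = hd (map fst l @ [0])"
    "\<And>h. h \<in> set l \<Longrightarrow> mem s (addr 2 (fst h)) = Suc (snd h) \<and> snd h < n \<and>
      0 < fst h \<and> fst h \<le> 4 * n \<and> (fst h - 1) div 4 < n"
    "\<And>x. 0 < mem s (addr 5 x) \<longleftrightarrow> x \<in> B"
  shows "\<exists>t s'. exec (ram n) i (While (Less (Const 0) cur) scan_body) s t s' \<and>
    out_tape s' = out_tape s @ greedy B (half_edges 4 l) \<and> t \<le> 1 + length l * Suc (max_time scan_body)"
  using assms
proof (induction l arbitrary: a s B)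
  case Nil
  then show ?case by (intro exI[of _ 1] exI[of _ s] conjI exec.WhileFalse) simp_all
next
  case (Cons h l)
  obtain z y where h: "h = (z, y)" by fastforce
  define x where "x = (z - 1) div 4"
  define free where "free \<longleftrightarrow> x \<notin> B \<and> y \<notin> B"
  define B' where "B' = (if free then insert x (insert y B) else B)"
  define out where "out = (if free then [(x, y)] else [])"
  define q where "q = hd (map fst l @ [0])"
  have z: "mem s (addr 6 0) = z" "mem s (addr 2 z) = Suc y" "y < n" "0 < z" "z \<le> 4 * n" "x < n"
    using Cons.prems(2) Cons.prems(3)[of h] by (simp_all add: h x_def)
  have x': "(z - Suc 0) div 4 = x" by (simp add: x_def)
  have dll: "dll (mem s) z (map fst l) 0" using Cons.prems(1) by (simp add: h)
  have q: "mem s (addr 0 z) = q" using dll_next[OF dll] by (simp add: q_def)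
  have "q \<in> set (map fst l @ [0])" unfolding q_def by (rule hd_in_set) simp
  then have "q \<le> 4 * n" using Cons.prems(3) by auto
  then have q': "q < 2 ^ word_bits (ram n)" by (intro word_ram) simp
  have mark: "mem s (addr 5 v) = 0 \<longleftrightarrow> v \<notin> B" for v using Cons.prems(4)[of v] by auto
  define s1 where "s1 = s\<lparr>mem := (mem s)(addr 6 0 := q)\<rparr>"
  define s2 where "s2 = s\<lparr>out_tape := out_tape s @ [(x, y)],
    mem := (mem s)(addr 5 x := 1, addr 5 y := 1, addr 6 0 := q)\<rparr>"
  have "wp (ram n) i scan_body (\<lambda>s'. s' = (if free then s2 else s1)) s"
    using z q q' word_ram[of 1 n] mark[of x] mark[of y]
    by (cases "x \<in> B"; cases "y \<in> B") (simp_all add: scan_body_def s1_def s2_def free_def x')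
  from wp_exec[OF this] obtain t1 s3 where exec1: "exec (ram n) i scan_body s t1 s3"
    "s3 = (if free then s2 else s1)" "t1 \<le> max_time scan_body" by auto
  have s3: "mem s3 (addr f c) = (if f = 6 \<and> c = 0 then q
      else if f = 5 \<and> free \<and> c \<in> {x, y} then 1 else mem s (addr f c))" if "f < 8" for f c
    using that by (auto simp: exec1(2) s1_def s2_def)
  have out: "out_tape s3 = out_tape s @ out" by (simp add: exec1(2) s1_def s2_def out_def)
  have "\<exists>t s'. exec (ram n) i (While (Less (Const 0) cur) scan_body) s3 t s' \<and>
    out_tape s' = out_tape s3 @ greedy B' (half_edges 4 l) \<and> t \<le> 1 + length l * Suc (max_time scan_body)"
  proof (rule Cons.IH)
    show "dll (mem s3) z (map fst l) 0" using dll by (rule dll_cong) (simp_all add: s3)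
    show "mem s3 (addr 6 0) = hd (map fst l @ [0])" by (simp add: s3 q_def)
    show "mem s3 (addr 2 (fst h)) = Suc (snd h) \<and> snd h < n \<and>
      0 < fst h \<and> fst h \<le> 4 * n \<and> (fst h - 1) div 4 < n" if "h \<in> set l" for h
      using Cons.prems(3)[of h] that by (simp add: s3)
    show "0 < mem s3 (addr 5 v) \<longleftrightarrow> v \<in> B'" for v
      using Cons.prems(4)[of v] by (auto simp: s3 B'_def)
  qed
  then obtain t2 s4 where exec2: "exec (ram n) i (While (Less (Const 0) cur) scan_body) s3 t2 s4"
    "out_tape s4 = out_tape s3 @ greedy B' (half_edges 4 l)"
    "t2 \<le> 1 + length l * Suc (max_time scan_body)" by blast
  have "greedy B (half_edges 4 (h # l)) = out @ greedy B' (half_edges 4 l)"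
    by (simp add: h out_def B'_def free_def x')
  moreover have "exec (ram n) i (While (Less (Const 0) cur) scan_body) s (Suc (t1 + t2)) s4"
    using z(1,4) exec1(1) exec2(1) by (intro exec.WhileTrue) simp_all
  moreover have "Suc (t1 + t2) \<le> 1 + length (h # l) * Suc (max_time scan_body)"
    using exec1(3) exec2(3) by simp
  moreover have "out_tape s4 = out_tape s @ out @ greedy B' (half_edges 4 l)"
    by (simp only: exec2(2) out append.assoc)
  ultimately show ?case by metis
qed

section \<open>The assembled algorithm and its guarantees\<close>

definition matching_alg :: stream_alg where
  "matching_alg = \<lparr>edge_prog = step_prog, final_prog = scan_prog, resources = ram\<rparr>"

lemma process_matching_alg:
  assumes "invariant n w S es s" "\<forall>(u, v) \<in> set xs. u < n \<and> v < n \<and> u \<noteq> v \<and> 0 \<le> w {u, v}"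
  shows "\<exists>ts s' es'. process matching_alg n w s xs ts s' \<and> invariant n w (S \<union> set xs) es' s'"
  using assms
proof (induction xs arbitrary: S es s)
  case Nil
  then show ?case using process.Nil by fastforce
next
  case (Cons e xs)
  obtain u v where e: "e = (u, v)" by fastforce
  define i where "i = \<lparr>num_vertices = n, in_u = u, in_v = v, in_w = w {u, v}\<rparr>"
  have "wp (ram n) i step_prog (\<lambda>s'. \<exists>es'. invariant n w (insert (u, v) S) es' s') s"
    unfolding i_def using Cons.prems e by (intro wp_step_prog) auto
  then obtain t s1 es1 where 1: "exec (ram n) i step_prog s t s1" "invariant n w (insert (u, v) S) es1 s1"
    using wp_exec by blast
  then obtain ts s' es' where "process matching_alg n w s1 xs ts s'"
    "invariant n w (insert (u, v) S \<union> set xs) es' s'" using Cons.IH[OF 1(2)] Cons.prems by auto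
  moreover from this 1(1) have "process matching_alg n w s (e # xs) (t # ts) s'"
    unfolding e by (intro process.Cons) (simp_all add: matching_alg_def i_def)
  ultimately show ?case unfolding e by fastforce
qed

lemma run_matching_alg:
  assumes stream: "weighted_graph_stream n E w xs"
  shows "\<exists>ts t M. run matching_alg n w xs ts t M \<and> matching E M \<and>
    max_matching_weight E w \<le> 4.8 * weight w M \<and> t \<le> 2 + 4 * n * Suc (max_time scan_body)"
proof -
  have E: "simple_graph n E" "\<And>e. e \<in> E \<Longrightarrow> 0 \<le> w e" "edge_of ` set xs = E"
    using stream by (simp_all add: weighted_graph_stream_def)
  have xs: "u < n \<and> v < n \<and> u \<noteq> v \<and> 0 \<le> w {u, v}" if "(u, v) \<in> set xs" for u v
  proof -
    have uv: "{u, v} \<in> E" using imageI[OF that, of edge_of] E(3) by simp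
    then have "{u, v} \<in> {{u, v} | u v. u < n \<and> v < n \<and> u \<noteq> v}"
      using E(1) unfolding simple_graph_def by (rule subsetD[rotated])
    then obtain x y where "{u, v} = {x, y}" "x < n" "y < n" "x \<noteq> y" by blast
    then show ?thesis using E(2)[OF uv] by (simp add: doubleton_eq_iff) blast
  qed
  have init: "invariant n w {} [] initial_state"
  proof -
    have "potential initial_state = (\<lambda>_. 0)" by (simp add: potential_def initial_state_def fun_eq_iff)
    then show ?thesis using history.Nil[of w n "1/16"] by (simp add: invariant_def linked_def initial_state_def)
  qed
  have "\<forall>(u, v) \<in> set xs. u < n \<and> v < n \<and> u \<noteq> v \<and> 0 \<le> w {u, v}"
    using xs by auto
  from process_matching_alg[OF init this] obtain ts s es where process: "process matching_alg n w initial_state xs ts s"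
    and inv: "invariant n w (set xs) es s"
    by auto
  define p where "p = potential s"
  define l where "l = buffer 4 (halves es)"
  define g where "g = greedy {} (half_edges 4 l)"
  define M where "M = edge_of ` set g"
  have I: "history w n (1/16) p es" "set es \<subseteq> set xs"
    "\<And>x y. (x, y) \<in> set xs \<Longrightarrow> w {x, y} \<le> 2 * (p x + p y)"
    "linked (mem s) (halves es)" "\<And>x. mem s (addr 5 x) = 0" "out_tape s = []"
    using inv by (auto simp: invariant_def p_def)
  have vertices: "\<forall>h \<in> set (halves es). fst h < n" "\<forall>h \<in> set (halves es). snd h < n"
    using history_vertices[OF I(1)] by auto
  have l: "mem s (addr 2 (fst h)) = Suc (snd h)" "snd h < n" "0 < fst h" "fst h \<le> 4 * n"
    "(fst h - 1) div 4 < n" "((fst h - 1) div 4, snd h) \<in> set (halves es)" if h_in: "h \<in> set l" for h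
  proof -
    show "mem s (addr 2 (fst h)) = Suc (snd h)" using I(4) that by (simp add: linked_def l_def)
    show "0 < fst h" "fst h \<le> 4 * n" "(fst h - 1) div 4 < n"
      using buffer_bounds[OF vertices(1)] that by (simp_all add: l_def)
    obtain x i where h: "(x, snd h) \<in> set (halves es)" "fst h = node 4 x i"
      using buffer_set[OF h_in[unfolded l_def]] by auto
    then show "((fst h - 1) div 4, snd h) \<in> set (halves es)" by simp
    show "snd h < n" using bspec[OF vertices(2) h(1)] by simp
  qed
  define i where "i = \<lparr>num_vertices = n, in_u = 0, in_v = 0, in_w = 0\<rparr>"
  have dll: "dll (mem s) 0 (map fst l) 0" using I(4) by (simp add: linked_def l_def)
  define q where "q = hd (map fst l @ [0])"
  define s1 where "s1 = s\<lparr>mem := (mem s)(addr 6 0 := q)\<rparr>"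
  have q: "mem s (addr 0 0) = q" using dll_next[OF dll] by (simp add: q_def)
  have "q \<in> set (map fst l @ [0])" unfolding q_def by (rule hd_in_set) simp
  then have "q \<le> 4 * n" using l(4) by auto
  then have q': "q < 2 ^ word_bits (ram n)" by (intro word_ram) simp
  have "exec (ram n) i (put 6 (Const 0) (get 0 (Const 0))) s 1
      (s\<lparr>mem := (mem s)(aval i s (cell 6 (Const 0)) := aval i s (get 0 (Const 0)))\<rparr>)"
    using q q' by (intro exec.Store) simp_all
  then have exec1: "exec (ram n) i (put 6 (Const 0) (get 0 (Const 0))) s 1 s1"
    using q by (simp add: s1_def)
  have "\<exists>t s'. exec (ram n) i (While (Less (Const 0) cur) scan_body) s1 t s' \<and>
    out_tape s' = out_tape s1 @ g \<and> t \<le> 1 + length l * Suc (max_time scan_body)"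
    unfolding g_def
  proof (rule exec_scan)
    show "dll (mem s1) 0 (map fst l) 0" using dll by (rule dll_cong) (simp_all add: s1_def)
    show "mem s1 (addr 6 0) = hd (map fst l @ [0])" by (simp add: s1_def q_def)
    show "mem s1 (addr 2 (fst h)) = Suc (snd h) \<and> snd h < n \<and>
      0 < fst h \<and> fst h \<le> 4 * n \<and> (fst h - 1) div 4 < n" if "h \<in> set l" for h
      using l[OF that] by (simp add: s1_def)
    show "0 < mem s1 (addr 5 x) \<longleftrightarrow> x \<in> {}" for x using I(5) by (simp add: s1_def)
  qed
  then obtain t s' where exec2: "exec (ram n) i (While (Less (Const 0) cur) scan_body) s1 t s'"
    "out_tape s' = g" "t \<le> 1 + length l * Suc (max_time scan_body)"
    using I(6) by (auto simp: s1_def)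
  have "exec (ram n) i scan_prog s (1 + t) s'"
    unfolding scan_prog_def using exec1 exec2(1) by (rule exec.Seq)
  then have run: "run matching_alg n w xs ts (1 + t) M"
    unfolding run_def using process exec2(2)
    by (intro exI[of _ s] exI[of _ s'] conjI) (simp_all add: matching_alg_def i_def M_def)
  \<comment> \<open>The nodes are distinct numbers from 1 to \<open>4 * n\<close>, so the scan is
    linear in \<open>n\<close> however long the stream was.\<close>
  have "length l \<le> 4 * n"
  proof -
    have "length l = card (set (map fst l))"
      using distinct_card[OF distinct_buffer[of 4 "halves es"]] by (simp add: l_def)
    also have "\<dots> \<le> card {1..4 * n}" using l(3,4) by (intro card_mono) (auto simp: Suc_le_eq)
    finally show ?thesis by simp
  qed
  then have "length l * Suc (max_time scan_body) \<le> 4 * n * Suc (max_time scan_body)"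
    by (rule mult_le_mono1)
  then have time: "1 + t \<le> 2 + 4 * n * Suc (max_time scan_body)" using exec2(3) by simp
  have "M \<subseteq> E"
  proof
    fix e assume "e \<in> M"
    then obtain h where h: "h \<in> set g" "e = edge_of h" by (auto simp: M_def)
    then have "h \<in> set (half_edges 4 l)" using greedy_subset[OF h(1)[unfolded g_def]] by simp
    then have "h \<in> set (halves es)" using l(6) by auto
    then have "h \<in> set xs \<or> prod.swap h \<in> set xs" using I(2) by (auto simp: set_halves)
    then show "e \<in> E"
    proof
      assume "h \<in> set xs"
      from imageI[OF this, of edge_of] show "e \<in> E" using E(3) h(2) by simp
    next
      assume "prod.swap h \<in> set xs"
      from imageI[OF this, of edge_of] show "e \<in> E" using E(3) h(2) by (simp add: insert_commute)
    qed
  qed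
  then have M: "matching E M"
    using greedy_disjoint[of _ "{}" "half_edges 4 l"] by (simp add: matching_def M_def g_def)
  \<comment> \<open>With nothing blocked and no newer pushes, \<open>live\<close> is the actual
    buffer; four slots and \<open>\<eta> = 1/16\<close> yield the factors \<open>15/16\<close> and
    \<open>9/4\<close>.\<close>
  have "(\<Sum>x<n. buffered 4 0 * p x) \<le> (2 + 2 * (1/16)) * (\<Sum>x\<in>{}. p x) + (2 + 4 * (1/16)) *
    sum_list (map (w \<circ> edge_of) (greedy {} (half_edges 4 (live 4 (\<lambda>_. 0) (halves es)))))"
    by (rule history_bound[OF I(1)]) simp_all
  also have "live 4 (\<lambda>_. 0) (halves es) = l" by (simp add: l_def buffer_live)
  also have "sum_list (map (w \<circ> edge_of) (greedy {} (half_edges 4 l))) = weight w M"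
    by (simp only: weight_greedy M_def g_def)
  finally have bound: "(\<Sum>x<n. buffered 4 0 * p x) \<le> 9/4 * weight w M" by simp
  have "(\<Sum>x<n. buffered 4 0 * p x) = 15/16 * (\<Sum>x<n. p x)"
    by (simp add: sum_distrib_left power_divide)
  then have potential: "2 * (\<Sum>x<n. p x) \<le> 4.8 * weight w M" using bound by simp
  have opt: "weight w M' \<le> 4.8 * weight w M" if "matching E M'" for M'
  proof -
    have "weight w M' \<le> 2 * (\<Sum>x<n. p x)"
    proof (rule weight_le_potential[OF E(1) that])
      fix u v assume "{u, v} \<in> E"
      then have "{u, v} \<in> edge_of ` set xs" using E(3) by simp
      then obtain x y where "(x, y) \<in> set xs" "{u, v} = {x, y}" by fastforce
      \<comment> \<open>The stream may list the endpoints in the other order; the inequality is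
        symmetric.\<close>
      then show "w {u, v} \<le> 2 * (p u + p v)" using I(3)[of x y] by (auto simp: doubleton_eq_iff insert_commute)
    qed (rule history_nonneg[OF I(1)])
    then show ?thesis using potential by simp
  qed
  have "finite E" using E(3) by blast
  then have "finite {M. matching E M}"
    by (rule finite_subset[rotated, OF finite_Pow_iff[THEN iffD2]]) (auto simp: matching_def)
  then have "max_matching_weight E w \<le> 4.8 * weight w M"
    unfolding max_matching_weight_def using opt M by (intro Max.boundedI) auto
  then show ?thesis using run M time by blast
qed

lemma semi_streaming_matching_alg: "semi_streaming matching_alg"
proof -
  have "(\<lambda>n. real (floorlog 2 n + 5)) \<in> O(\<lambda>n. ln (real n))"
  \<comment> \<open>For \<open>n \<ge> 2\<close> the binary logarithm is at least 1, so it absorbs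
    the additive 6 into the factor 7.\<close>
  proof (rule bigoI[of _ "7 / ln 2"], rule eventually_mono[OF eventually_ge_at_top[of 2]])
    fix n :: nat assume n: "2 \<le> n"
    then have log: "1 \<le> log 2 (real n)" by simp
    have "real (floorlog 2 n) \<le> log 2 (real n) + 1" using n log by (simp add: floorlog_def)
    then have "real (floorlog 2 n + 5) \<le> 7 * log 2 (real n)" using log by simp
    then show "norm (real (floorlog 2 n + 5)) \<le> 7 / ln 2 * norm (ln (real n))"
      using n by (simp add: log_def)
  qed
  then have word: "(\<lambda>n. real (word_bits (resources matching_alg n))) \<in> O(\<lambda>n. ln (real n))"
    by (simp add: matching_alg_def ram_def)
  \<comment> \<open>The sum of \<open>32 * n + 8\<close> word cells and \<open>n\<close> weight
    cells.\<close>
  have "(\<lambda>n. real (33 * n + 8)) \<in> O(\<lambda>n. real n)"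
    by (rule bigoI[of _ 41], rule eventually_mono[OF eventually_ge_at_top[of 1]]) simp
  from landau_o.big.mult[OF this word]
  have "(\<lambda>n. real (space_bits matching_alg n)) \<in> O(\<lambda>n. real n * ln (real n) ^ 1)"
    by (simp add: space_bits_def matching_alg_def ram_def algebra_simps)
  then show ?thesis using word unfolding semi_streaming_def by blast
qed

lemma constant_time_matching_alg: "constant_time_per_edge matching_alg"
proof -
  have lf: "loop_free step_prog"
    by (simp add: step_prog_def push_half_def unlink_def insert_front_def)
  have "\<forall>t \<in> set ts. t \<le> max_time step_prog" if "process matching_alg n w s xs ts s'" for n w s xs ts s'
    using that by (induction rule: process.induct)
      (auto simp: matching_alg_def intro: exec_max_time[OF _ lf])
  then show ?thesis unfolding constant_time_per_edge_def run_def by blast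
qed

lemma linear_final_time_matching_alg: "linear_final_time matching_alg"
proof -
  define c where "c = Suc (max_time scan_body)"
  have "(\<lambda>n. real (2 + 4 * n * c)) \<in> O(\<lambda>n. real n)"
  proof (rule bigoI[of _ "2 + 4 * real c"], rule eventually_mono[OF eventually_ge_at_top[of 1]])
    fix n :: nat assume "1 \<le> n"
    then show "norm (real (2 + 4 * n * c)) \<le> (2 + 4 * real c) * norm (real n)"
      by (simp add: algebra_simps)
  qed
  moreover have "t \<le> 2 + 4 * n * c"
    if "weighted_graph_stream n E w xs" "run matching_alg n w xs ts t M" for n E w xs ts t M
    using run_matching_alg[OF that(1)] run_deterministic[OF _ that(2)] unfolding c_def by metis
  ultimately show ?thesis unfolding linear_final_time_def
    by (intro exI[of _ "\<lambda>n. 2 + 4 * n * c"]) blast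
qed

theorem theorem2p9:
  fixes \<epsilon> :: real
  assumes "\<epsilon> > 0"
  shows "\<exists>A. semi_streaming A \<and> approximation_algorithm (4.9108 + \<epsilon>) A \<and>
    constant_time_per_edge A \<and> linear_final_time A"
proof (intro exI conjI)
  show "approximation_algorithm (4.9108 + \<epsilon>) matching_alg"
    unfolding approximation_algorithm_def
  proof (intro allI impI)
    fix n E w xs assume stream: "weighted_graph_stream n E w xs"
    then obtain ts t M where M: "run matching_alg n w xs ts t M" "matching E M"
      "max_matching_weight E w \<le> 4.8 * weight w M" using run_matching_alg by blast
    \<comment> \<open>A nonnegative weight allows the factor 4.8 to be enlarged.\<close>
    have "0 \<le> weight w M" unfolding weight_def
      using M(2) stream by (intro sum_nonneg) (auto simp: matching_def weighted_graph_stream_def)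
    then have "4.8 * weight w M \<le> (4.9108 + \<epsilon>) * weight w M"
      using assms by (intro mult_right_mono) auto
    then show "\<exists>ts t M. run matching_alg n w xs ts t M \<and> matching E M \<and>
      max_matching_weight E w \<le> (4.9108 + \<epsilon>) * weight w M" using M by force
  qed
qed (rule semi_streaming_matching_alg constant_time_matching_alg linear_final_time_matching_alg)+

end
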